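(* Let $A(t)=(a_{jk}(t))$, $B(t)$, $C(t)$ be complex-valued continuous $2\times2$ matrix functions on $[t_0;+\infty)$ with $B=B^*$, $C=C^*$. Assume: 1') $B(t)\ge0$ (nonnegative definite) for $t\ge t_0$, and its nonnegative definite square root $\sqrt{B(t)}$ is continuously differentiable on $[t_0;+\infty)$; 2') there is a continuous $2\times2$ matrix function $F(t)$ on $[t_0;+\infty)$ satisfying $$\sqrt{B(t)}\,F(t)\bigl[A(t)\sqrt{B(t)}-\sqrt{B(t)}\,'\bigr]=A(t)\sqrt{B(t)}-\sqrt{B(t)}\,',\qquad t\ge t_0;$$ define $P(t)=F(t)\bigl[A(t)\sqrt{B(t)}-\sqrt{B(t)}\,'\bigr]=(p_{jk}(t))_{j,k=1}^2$ and $Q(t)=\sqrt{B(t)}\,C(t)\sqrt{B(t)}=(q_{jk}(t))_{j,k=1}^2$; 3') $p_{12}(t)$ and $p_{21}(t)$ are continuously differentiable on $[t_0;+\infty)$; 4') for $j=1,2$ there exist strictly increasing sequences $\xi_{j,0}=t_0<\xi_{j,1}<\dots<\xi_{j,m}<\dots$ with $\xi_{j,m}\to+\infty$ such that for all $m=0,1,2,\dots$ and all $t\in[\xi_{j,m};\xi_{j,m+1})$ $$\int_{\xi_{j,m}}^{t}\exp\Bigl\{\int_{\xi_{j,m}}^{\tau}\bigl[2\,\mathrm{Re}\,p_{jj}(s)-\widetilde{I}_{j+2}(\xi_{j,m};s)\bigr]ds\Bigr\}\widetilde{\chi}_{j+2}(\tau)\,d\tau\le0,$$ where, for $t\ge t_0$,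 $t\ge\xi\ge t_0$, $$\widetilde{\mathfrak{M}}(t)=\max_{\tau\in[t_0;t]}\Bigl|\exp\Bigl\{-\int_\tau^t\bigl(\overline{p}_{11}(s)+p_{22}(s)\bigr)ds\Bigr\}\bigl(p_{12}(\tau)-\overline{p}_{21}(\tau)\bigr)\Bigr|,$$ $$\widetilde{\chi}_3(t)=\biggl[\widetilde{\mathfrak{M}}(t)+\int_{t_0}^t\Bigl|\exp\Bigl\{-\int_\tau^t\bigl(\overline{p}_{11}(s)+p_{22}(s)\bigr)ds\Bigr\}\bigl[\overline{p}_{21}\,'(\tau)+\overline{p}_{21}(\tau)(\overline{p}_{11}(\tau)+p_{22}(\tau))+q_{12}(\tau)\bigr]\Bigr|d\tau\biggr]^2-|p_{21}(t)|^2-q_{11}(t),$$ $$\widetilde{\chi}_4(t)=\biggl[\widetilde{\mathfrak{M}}(t)+\int_{t_0}^t\Bigl|\exp\Bigl\{-\int_\tau^t\bigl(\overline{p}_{11}(s)+p_{22}(s)\bigr)ds\Bigr\}\bigl[p_{12}\,'(\tau)+p_{12}(\tau)(\overline{p}_{11}(\tau)+p_{22}(\tau))+q_{12}(\tau)\bigr]\Bigr|d\tau\biggr]^2-|p_{12}(t)|^2-q_{22}(t),$$ $$\widetilde{I}_{j+2}(\xi;t)=\int_\xi^t\exp\Bigl\{-\int_\tau^t2\,\mathrm{Re}\,p_{jj}(s)\,ds\Bigr\}\widetilde{\chi}_{j+2}(\tau)\,d\tau,\quad j=1,2.$$ Then the Hamiltonian system $\phi'=A(t)\phi+B(t)\psi,\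 \psi'=C(t)\phi-A^*(t)\psi$, $t\ge t_0$, is non oscillatory.
   Context: For the system $\phi'=A(t)\phi+B(t)\psi,\ \psi'=C(t)\phi-A^*(t)\psi$ consider the matrix system $\Phi'=A(t)\Phi+B(t)\Psi,\ \Psi'=C(t)\Phi-A^*(t)\Psi$ with $2\times2$ matrix unknowns. A solution $(\Phi,\Psi)$ is conjoined if $\Phi^*\Psi=\Psi^*\Phi$ on $[t_0;+\infty)$, and oscillatory if $\det\Phi(t)$ has arbitrarily large zeros. The Hamiltonian system is oscillatory if all conjoined solutions of the matrix system are oscillatory, and non oscillatory otherwise. $\sqrt{B(t)}\,'$ denotes the derivative of $\sqrt{B(t)}$; overline denotes complex conjugation. *)

theory Defs
  imports "HOL-Analysis.Analysis"
begin

definition cadj :: "complex^'n^'n \<Rightarrow> complex^'n^'n" where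
  "cadj M = (\<chi> i j. cnj (M $ j $ i))"

definition nonneg_def :: "complex^'n^'n \<Rightarrow> bool" where
  "nonneg_def M \<longleftrightarrow> cadj M = M \<and>
     (\<forall>v::complex^'n. 0 \<le> Re (\<Sum>i\<in>UNIV. cnj (v $ i) * (M *v v) $ i))"

definition msqrt :: "complex^'n^'n \<Rightarrow> complex^'n^'n" where
  "msqrt M = (THE S. nonneg_def S \<and> S ** S = M)"

definition ham_matrix_solution ::
  "(real \<Rightarrow> complex^2^2) \<Rightarrow> (real \<Rightarrow> complex^2^2) \<Rightarrow> (real \<Rightarrow> complex^2^2) \<Rightarrow> real
   \<Rightarrow> (real \<Rightarrow> complex^2^2) \<Rightarrow> (real \<Rightarrow> complex^2^2) \<Rightarrow> bool" where
  "ham_matrix_solution A B C t0 \<Phi> \<Psi> \<longleftrightarrow>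
     (\<forall>t\<ge>t0. (\<Phi> has_vector_derivative (A t ** \<Phi> t + B t ** \<Psi> t)) (at t within {t0..}) \<and>
              (\<Psi> has_vector_derivative (C t ** \<Phi> t - cadj (A t) ** \<Psi> t)) (at t within {t0..}))"

definition conjoined :: "real \<Rightarrow> (real \<Rightarrow> complex^2^2) \<Rightarrow> (real \<Rightarrow> complex^2^2) \<Rightarrow> bool" where
  "conjoined t0 \<Phi> \<Psi> \<longleftrightarrow> (\<forall>t\<ge>t0. cadj (\<Phi> t) ** \<Psi> t = cadj (\<Psi> t) ** \<Phi> t)"

definition oscillatory_sol :: "real \<Rightarrow> (real \<Rightarrow> complex^2^2) \<Rightarrow> bool" where
  "oscillatory_sol t0 \<Phi> \<longleftrightarrow> (\<forall>T. \<exists>t\<ge>max T t0. det (\<Phi> t) = 0)"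

definition ham_non_oscillatory ::
  "(real \<Rightarrow> complex^2^2) \<Rightarrow> (real \<Rightarrow> complex^2^2) \<Rightarrow> (real \<Rightarrow> complex^2^2) \<Rightarrow> real \<Rightarrow> bool" where
  "ham_non_oscillatory A B C t0 \<longleftrightarrow>
     (\<exists>\<Phi> \<Psi>. ham_matrix_solution A B C t0 \<Phi> \<Psi> \<and> conjoined t0 \<Phi> \<Psi> \<and> \<not> oscillatory_sol t0 \<Phi>)"

definition Ekern :: "(real \<Rightarrow> complex^2^2) \<Rightarrow> real \<Rightarrow> real \<Rightarrow> complex" where
  "Ekern P \<tau> t = exp (- integral {\<tau>..t} (\<lambda>s. cnj (P s $ 1 $ 1) + P s $ 2 $ 2))"

definition Mtil :: "(real \<Rightarrow> complex^2^2) \<Rightarrow> real \<Rightarrow> real \<Rightarrow> real" where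
  "Mtil P t0 t = (SUP \<tau>\<in>{t0..t}. cmod (Ekern P \<tau> t * (P \<tau> $ 1 $ 2 - cnj (P \<tau> $ 2 $ 1))))"

definition chi3 :: "(real \<Rightarrow> complex^2^2) \<Rightarrow> (real \<Rightarrow> complex^2^2) \<Rightarrow> (real \<Rightarrow> complex)
                    \<Rightarrow> real \<Rightarrow> real \<Rightarrow> real" where
  "chi3 P Q dp21 t0 t =
     (Mtil P t0 t + integral {t0..t} (\<lambda>\<tau>. cmod (Ekern P \<tau> t *
        (cnj (dp21 \<tau>) + cnj (P \<tau> $ 2 $ 1) * (cnj (P \<tau> $ 1 $ 1) + P \<tau> $ 2 $ 2) + Q \<tau> $ 1 $ 2))))\<^sup>2
     - (cmod (P t $ 2 $ 1))\<^sup>2 - Re (Q t $ 1 $ 1)"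

definition chi4 :: "(real \<Rightarrow> complex^2^2) \<Rightarrow> (real \<Rightarrow> complex^2^2) \<Rightarrow> (real \<Rightarrow> complex)
                    \<Rightarrow> real \<Rightarrow> real \<Rightarrow> real" where
  "chi4 P Q dp12 t0 t =
     (Mtil P t0 t + integral {t0..t} (\<lambda>\<tau>. cmod (Ekern P \<tau> t *
        (dp12 \<tau> + P \<tau> $ 1 $ 2 * (cnj (P \<tau> $ 1 $ 1) + P \<tau> $ 2 $ 2) + Q \<tau> $ 1 $ 2))))\<^sup>2
     - (cmod (P t $ 1 $ 2))\<^sup>2 - Re (Q t $ 2 $ 2)"

text \<open>I_{j+2}(xi; t), with rp = Re p_jj and chi = chi_{j+2}.\<close>
definition Itil :: "(real \<Rightarrow> real) \<Rightarrow> (real \<Rightarrow> real) \<Rightarrow> real \<Rightarrow> real \<Rightarrow> real" where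
  "Itil rp chi \<xi> t = integral {\<xi>..t} (\<lambda>\<tau>. exp (- integral {\<tau>..t} (\<lambda>s. 2 * rp s)) * chi \<tau>)"

definition cond4 :: "(real \<Rightarrow> real) \<Rightarrow> (real \<Rightarrow> real) \<Rightarrow> real \<Rightarrow> bool" where
  "cond4 rp chi t0 \<longleftrightarrow> (\<exists>\<xi>::nat \<Rightarrow> real. \<xi> 0 = t0 \<and> strict_mono \<xi> \<and> filterlim \<xi> at_top sequentially \<and>
     (\<forall>m t. \<xi> m \<le> t \<and> t < \<xi> (Suc m) \<longrightarrow>
        integral {\<xi> m..t} (\<lambda>\<tau>. exp (integral {\<xi> m..\<tau>} (\<lambda>s. 2 * rp s - Itil rp chi (\<xi> m) s)) * chi \<tau>) \<le> 0))"

end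

theory Submission
  imports Defs
begin

text \<open>
  Write \<open>S\<close> for the square root of \<open>B\<close>. The hypotheses give \<open>S' = A S - S P\<close>, so \<open>Z = S Y S\<close> turns the
  Riccati equation of the Hamiltonian system into \<open>Z' + Z\<^sup>2 + P\<^sup>* Z + Z P - Q = 0\<close>. Start it from unit
  diagonal and \<open>z\<^sub>1\<^sub>2 = - p\<^sub>1\<^sub>2\<close>. As long as the diagonal of \<open>Z\<close> is nonnegative, the linear equations for
  \<open>z\<^sub>1\<^sub>2 + cnj p\<^sub>2\<^sub>1\<close> and \<open>z\<^sub>1\<^sub>2 + p\<^sub>1\<^sub>2\<close> bound these quantities by the brackets in \<open>chi3\<close> and \<open>chi4\<close>, so that
  each diagonal entry is a supersolution of a scalar Riccati equation for which the sign condition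
  yields a nonnegative subsolution. Hence the diagonal stays positive, and since \<open>Z = V X\<^sup>-\<^sup>1\<close> with
  \<open>(det X)' = tr (P + Z) det X\<close>, the solution \<open>Z\<close> is global.

  When \<open>S\<close> is singular, \<open>Z\<close> need not be of the form \<open>S Y S\<close>. The equation for \<open>S\<close> makes its rank constant.
  In rank one, all zeros of a suitable \<open>det \<Phi>\<close> come from one vector solution \<open>(\<phi>, \<psi>)\<close> with \<open>\<phi> = S X\<close> and
  \<open>X' = P X + S \<psi>\<close>, for which the derivative of \<open>\<psi> \<bullet> \<phi> - X \<bullet> Z X\<close> is \<open>\<parallel>S \<psi> - Z X\<parallel>\<^sup>2\<close>. Three zeros of \<open>\<phi>\<close> allow two
  multiples of \<open>(\<phi>, \<psi>)\<close>, on the two intervals between them, to be lifted to one \<open>X\<close> that vanishes at both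
  ends; monotonicity then forces \<open>X = 0\<close>, and with it \<open>\<phi> = 0\<close>.
\<close>

section \<open>Linear differential equations\<close>

lemma at_within_Icc_eq_Ici:
  fixes t :: real
  assumes "a \<le> t" "t < b"
  shows "at t within {a..b} = at t within {a..}"
  by (rule at_within_nhd[of t "{..<b}"]) (use assms in auto)

lemma integral_has_vector_derivative_Ici:
  fixes f :: "real \<Rightarrow> 'a::banach"
  assumes "continuous_on {a..} f" "a \<le> t"
  shows "((\<lambda>u. integral {a..u} f) has_vector_derivative f t) (at t within {a..})"
proof -
  \<comment> \<open>The right end lies strictly beyond \<open>t\<close>, so that the derivative
    within the compact interval is also the derivative within the half-line.\<close>
  have "continuous_on {a..t+1} f"
    by (rule continuous_on_subset[OF assms(1)]) auto
  from integral_has_vector_derivative[OF this, of t] assms(2)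
  have "((\<lambda>u. integral {a..u} f) has_vector_derivative f t) (at t within {a..t+1})" by simp
  then show ?thesis using at_within_Icc_eq_Ici[of a t "t+1"] assms(2) by simp
qed

lemma has_vector_derivative_imp_continuous_on:
  assumes "\<And>t. t \<in> A \<Longrightarrow> (f has_vector_derivative f' t) (at t within A)"
  shows "continuous_on A f"
  using assms has_vector_derivative_continuous continuous_on_eq_continuous_within by blast

lemma continuous_on_integral_Ici:
  fixes f :: "real \<Rightarrow> 'a::banach"
  assumes "continuous_on {a..} f"
  shows "continuous_on {a..} (\<lambda>t. integral {a..t} f)"
  by (rule has_vector_derivative_imp_continuous_on)
    (use integral_has_vector_derivative_Ici[OF assms] in auto)

lemma vector_derivative_nonneg_imp_mono:
  fixes f :: "real \<Rightarrow> real"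
  assumes "a \<le> b"
    and d: "\<And>x. x \<in> {a..b} \<Longrightarrow> (f has_vector_derivative f' x) (at x within {a..b})"
    and nn: "\<And>x. x \<in> {a..b} \<Longrightarrow> 0 \<le> f' x"
  shows "f a \<le> f b"
proof (cases "a = b")
  case False
  show ?thesis
  proof (rule DERIV_nonneg_imp_increasing_open[of a b f])
    fix x assume x: "a < x" "x < b"
    have "at x within {a..b} = at x"
      by (rule at_within_interior) (use x in simp)
    then have "(f has_real_derivative f' x) (at x)"
      using d[of x] x by (simp add: has_real_derivative_iff_has_vector_derivative)
    then show "\<exists>y. DERIV f x :> y \<and> 0 \<le> y" using nn[of x] x by auto
  qed (use assms(1) has_vector_derivative_imp_continuous_on[of "{a..b}" f f', OF d] in auto)
qed simp

lemma vector_derivative_norm_bound: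
  fixes f :: "real \<Rightarrow> 'a::real_normed_vector" and g :: "real \<Rightarrow> real"
  assumes "a \<le> b"
    and f: "\<And>x. x \<in> {a..b} \<Longrightarrow> (f has_vector_derivative f' x) (at x within {a..b})"
    and g: "\<And>x. x \<in> {a..b} \<Longrightarrow> (g has_vector_derivative g' x) (at x within {a..b})"
    and bd: "\<And>x. x \<in> {a..b} \<Longrightarrow> norm (f' x) \<le> g' x"
  shows "norm (f b - f a) \<le> g b - g a"
proof (cases "a = b")
  case False
  have eq: "at x within {a..b} = at x" if "a < x" "x < b" for x
    by (rule at_within_interior) (use that in simp)
  show ?thesis
  proof (rule differentiable_bound_general[of a b f g f' g'])
    fix x assume x: "a < x" "x < b"
    show "(f has_vector_derivative f' x) (at x)" "(g has_vector_derivative g' x) (at x)"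
      using f[of x] g[of x] eq[of x] x by simp_all
  qed (use False assms(1) bd has_vector_derivative_imp_continuous_on[OF f]
        has_vector_derivative_imp_continuous_on[OF g] in auto)
qed simp

text \<open>Picard iteration written as a series of increments. The increments are bounded by
  \<open>M * (K * (t - t0)) ^ n / fact n\<close> on compact intervals, so the series converges
  uniformly there, and so does the series of derivatives, which is \<open>b\<close> plus
  \<open>L\<close> applied to the partial sums.\<close>

lemma linear_ode_exists:
  fixes L :: "real \<Rightarrow> 'a::banach \<Rightarrow> 'a" and t0 :: real
  assumes lin: "\<And>t. t \<ge> t0 \<Longrightarrow> linear (L t)"
    and bnd: "\<And>T. \<exists>K. \<forall>t\<in>{t0..T}. \<forall>x. norm (L t x) \<le> K * norm x"
    and cont: "\<And>y. continuous_on {t0..} y \<Longrightarrow> continuous_on {t0..} (\<lambda>t. L t (y t))"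
    and b: "continuous_on {t0..} b"
  obtains y where "y t0 = c"
    "\<And>t. t \<ge> t0 \<Longrightarrow> (y has_vector_derivative (L t (y t) + b t)) (at t within {t0..})"
proof -
  \<comment> \<open>\<open>Y n\<close> is the n-th increment of the iteration: the constant and the
    inhomogeneity enter only \<open>Y 0\<close>, and each later term is the integral of
    \<open>L\<close> applied to the one before.\<close>
  define Y where "Y = rec_nat (\<lambda>t. c + integral {t0..t} b) (\<lambda>_ f t. integral {t0..t} (\<lambda>s. L s (f s)))"
  have Y0: "Y 0 = (\<lambda>t. c + integral {t0..t} b)"
    and YS: "Y (Suc n) = (\<lambda>t. integral {t0..t} (\<lambda>s. L s (Y n s)))" for n
    by (simp_all add: Y_def)
  have contY: "continuous_on {t0..} (Y n)" for n
  proof (induction n)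
    case 0 show ?case unfolding Y0 by (intro continuous_intros continuous_on_integral_Ici b)
  next
    case (Suc n) show ?case unfolding YS by (intro continuous_on_integral_Ici cont Suc)
  qed
  define D where "D n = (case n of 0 \<Rightarrow> b | Suc m \<Rightarrow> (\<lambda>t. L t (Y m t)))" for n
  have derY: "(Y n has_vector_derivative D n t) (at t within {t0..})" if "t \<ge> t0" for n t
  proof (cases n)
    case 0
    have "((\<lambda>t. c + integral {t0..t} b) has_vector_derivative 0 + b t) (at t within {t0..})"
      by (intro has_vector_derivative_add has_vector_derivative_const
          integral_has_vector_derivative_Ici b that)
    then show ?thesis using 0 by (simp add: Y0 D_def)
  next
    case (Suc m)
    then show ?thesis
      using integral_has_vector_derivative_Ici[OF cont[OF contY] that] by (simp add: YS D_def)
  qed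
  define y where "y t = (\<Sum>n. Y n t)" for t
  have main: "(\<lambda>n. Y n t) sums y t \<and> (y has_vector_derivative (L t (y t) + b t)) (at t within {t0..})"
    if t: "t \<ge> t0" for t
  proof -
    \<comment> \<open>Convergence is uniform only on compact intervals; this one contains
      \<open>t\<close> away from its right end.\<close>
    define T where "T = t + 1"
    obtain K0 where K0: "\<forall>t\<in>{t0..T}. \<forall>x. norm (L t x) \<le> K0 * norm x" using bnd by blast
    define K where "K = \<bar>K0\<bar>"
    have K: "norm (L s x) \<le> K * norm x" if "s \<in> {t0..T}" for s x
      using K0 that by (smt (verit) K_def mult_right_mono norm_ge_zero)
    have "K \<ge> 0" by (simp add: K_def)
    have "compact (Y 0 ` {t0..T})"
      by (rule compact_continuous_image) (auto intro: continuous_on_subset[OF contY])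
    then obtain M where M: "\<forall>s\<in>{t0..T}. norm (Y 0 s) \<le> M"
      using compact_imp_bounded[of "Y 0 ` {t0..T}"] unfolding bounded_iff by auto
    have bd: "norm (Y n s) \<le> M * (K * (s - t0)) ^ n / fact n" if "s \<in> {t0..T}" for n s
      using that
    proof (induction n arbitrary: s)
      case 0 then show ?case using M by simp
    next
      case (Suc n)
      \<comment> \<open>A majorant whose derivative is \<open>K\<close> times the majorant of the
        previous increment.\<close>
      let ?g = "\<lambda>s. M * (K * (s - t0)) ^ Suc n / fact (Suc n)"
      have g: "(?g has_vector_derivative K * (M * (K * (x - t0)) ^ n / fact n)) (at x within {t0..s})" for x
      proof -
        have "((\<lambda>s. K * (s - t0)) has_real_derivative K) (at x within {t0..s})"
          by (auto intro!: derivative_eq_intros)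
        from DERIV_cmult[OF DERIV_power_Suc[OF this], of "M / fact (Suc n)" n]
        have "(?g has_real_derivative M / fact (Suc n) * ((1 + real n) * (K * (K * (x - t0)) ^ n)))
            (at x within {t0..s})" by simp
        moreover have "M / fact (Suc n) * ((1 + real n) * (K * (K * (x - t0)) ^ n))
            = K * (M * (K * (x - t0)) ^ n / fact n)"
        proof -
          have "M / (a * f) * (a * (K * p)) = K * (M * p / f)" if "a \<noteq> 0" for a f p :: real
            using that by simp
          from this[of "1 + real n"] show ?thesis by (simp add: fact_Suc add.commute)
        qed
        ultimately show ?thesis
          unfolding has_real_derivative_iff_has_vector_derivative[symmetric] by metis
      qed
      have "norm (Y (Suc n) s - Y (Suc n) t0) \<le> ?g s - ?g t0"
      proof (rule vector_derivative_norm_bound[where f'="D (Suc n)"])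
        show "t0 \<le> s" using Suc by simp
        fix x assume x: "x \<in> {t0..s}"
        show "(Y (Suc n) has_vector_derivative D (Suc n) x) (at x within {t0..s})"
          by (rule has_vector_derivative_within_subset[OF derY]) (use x in auto)
        show "(?g has_vector_derivative K * (M * (K * (x - t0)) ^ n / fact n)) (at x within {t0..s})"
          by (rule g)
        have "norm (D (Suc n) x) \<le> K * norm (Y n x)"
          using K[of x "Y n x"] x Suc by (simp add: D_def)
        also have "\<dots> \<le> K * (M * (K * (x - t0)) ^ n / fact n)"
          by (rule mult_left_mono[OF Suc.IH]) (use x Suc \<open>K \<ge> 0\<close> in auto)
        finally show "norm (D (Suc n) x) \<le> K * (M * (K * (x - t0)) ^ n / fact n)" .
      qed
      then show ?case by (simp add: YS)
    qed
    have "0 \<le> M" using bspec[OF M, of t] norm_ge_zero[of "Y 0 t"] t by (smt (verit) T_def atLeastAtMost_iff)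
    define R where "R n = M * (K * (T - t0)) ^ n / fact n" for n
    have R: "norm (Y n s) \<le> R n" if "s \<in> {t0..T}" for n s
    proof -
      have "M * (K * (s - t0)) ^ n / fact n \<le> R n" unfolding R_def
        by (intro divide_right_mono mult_left_mono power_mono)
          (use that \<open>K \<ge> 0\<close> \<open>M \<ge> 0\<close> in auto)
      then show ?thesis using bd[OF that, of n] by linarith
    qed
    have sR: "summable R"
      using summable_mult[OF summable_exp[of "K * (T - t0)"], of M]
      by (simp add: R_def[abs_def] field_simps)
    have ul: "uniform_limit {t0..T} (\<lambda>n s. \<Sum>i<n. Y i s) y sequentially"
      unfolding y_def[abs_def] by (rule Weierstrass_m_test[OF _ sR]) (rule R)
    have sy: "(\<lambda>n. Y n s) sums y s" if "s \<in> {t0..T}" for s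
      using tendsto_uniform_limitI[OF ul that] by (simp add: sums_def)
    have "\<exists>g. \<forall>x\<in>{t0..T}. (\<lambda>n. Y n x) sums g x \<and>
        (g has_derivative (\<lambda>h. h *\<^sub>R (L x (y x) + b x))) (at x within {t0..T})"
    proof (rule has_derivative_series[where f' = "\<lambda>n x h. h *\<^sub>R D n x"])
      show "convex {t0..T}" by simp
      show "(Y n has_derivative (\<lambda>h. h *\<^sub>R D n x)) (at x within {t0..T})" if "x \<in> {t0..T}" for n x
        using has_vector_derivative_within_subset[OF derY[of x n], of "{t0..T}"] that
        by (simp add: has_vector_derivative_def subset_iff)
      show "t \<in> {t0..T}" "(\<lambda>n. Y n t) sums y t" using t sy by (auto simp: T_def)
      fix e :: real assume "e > 0"
      \<comment> \<open>Dividing by \<open>K + 1\<close> instead of \<open>K\<close> covers the case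
        \<open>K = 0\<close>.\<close>
      then have e: "e / (K + 1) > 0" using \<open>K \<ge> 0\<close> by simp
      have "\<forall>\<^sub>F n in sequentially. \<forall>x\<in>{t0..T}. dist (\<Sum>i<n. Y i x) (y x) < e / (K + 1)"
        using uniform_limitD[OF ul e] .
      then obtain N where N: "\<And>n x. n \<ge> N \<Longrightarrow> x\<in>{t0..T} \<Longrightarrow> dist (\<Sum>i<n. Y i x) (y x) < e / (K + 1)"
        unfolding eventually_sequentially by blast
      have "\<forall>x\<in>{t0..T}. \<forall>h. norm ((\<Sum>i<n. h *\<^sub>R D i x) - h *\<^sub>R (L x (y x) + b x)) \<le> e * norm h"
        if n: "n \<ge> Suc N" for n
      proof (intro ballI allI)
        fix x h assume x: "x \<in> {t0..T}"
        obtain m where m: "n = Suc m" "m \<ge> N" using n by (cases n) auto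
        interpret l: linear "L x" using lin x by simp
        \<comment> \<open>Differentiation shifts the index: the first term gives \<open>b\<close>,
          the others \<open>L\<close> applied to a partial sum with one term fewer. This is why
          \<open>n\<close> must be at least \<open>Suc N\<close>.\<close>
        have "(\<Sum>i<n. D i x) = b x + (\<Sum>i<m. L x (Y i x))"
          unfolding m(1) sum.lessThan_Suc_shift by (simp add: D_def)
        also have "\<dots> - (L x (y x) + b x) = L x ((\<Sum>i<m. Y i x) - y x)"
          by (simp add: l.diff l.sum)
        finally have eq: "(\<Sum>i<n. D i x) - (L x (y x) + b x) = L x ((\<Sum>i<m. Y i x) - y x)" by simp
        have "norm (L x ((\<Sum>i<m. Y i x) - y x)) \<le> K * norm ((\<Sum>i<m. Y i x) - y x)"
          by (rule K[OF x])
        also have "\<dots> \<le> K * (e / (K + 1))"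
          by (rule mult_left_mono) (use N[OF m(2) x] \<open>K \<ge> 0\<close> in \<open>auto simp: dist_norm\<close>)
        also have "\<dots> \<le> e" using \<open>K \<ge> 0\<close> \<open>e > 0\<close> by (simp add: field_simps)
        finally have "norm ((\<Sum>i<n. D i x) - (L x (y x) + b x)) \<le> e" unfolding eq .
        then have "\<bar>h\<bar> * norm ((\<Sum>i<n. D i x) - (L x (y x) + b x)) \<le> \<bar>h\<bar> * e"
          by (rule mult_left_mono) simp
        then show "norm ((\<Sum>i<n. h *\<^sub>R D i x) - h *\<^sub>R (L x (y x) + b x)) \<le> e * norm h"
          by (simp add: scaleR_sum_right[symmetric] scaleR_diff_right[symmetric] mult.commute)
      qed
      then show "\<forall>\<^sub>F n in sequentially. \<forall>x\<in>{t0..T}. \<forall>h.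
          norm ((\<Sum>i<n. h *\<^sub>R D i x) - h *\<^sub>R (L x (y x) + b x)) \<le> e * norm h"
        unfolding eventually_sequentially by blast
    qed
    then obtain g where g: "\<And>x. x \<in> {t0..T} \<Longrightarrow> (\<lambda>n. Y n x) sums g x"
      "\<And>x. x \<in> {t0..T} \<Longrightarrow> (g has_derivative (\<lambda>h. h *\<^sub>R (L x (y x) + b x))) (at x within {t0..T})" by blast
    have gy: "g x = y x" if "x \<in> {t0..T}" for x using sums_unique2[OF g(1) sy] that by blast
    have tT: "t \<in> {t0..T}" using t by (simp add: T_def)
    have "(y has_vector_derivative (L t (y t) + b t)) (at t within {t0..T})"
      unfolding has_vector_derivative_def
      by (rule has_derivative_transform[OF tT _ g(2)[OF tT]]) (simp add: gy)
    then have "(y has_vector_derivative (L t (y t) + b t)) (at t within {t0..})"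
      using at_within_Icc_eq_Ici[of t0 t T] t by (simp add: T_def)
    then show ?thesis using sy[OF tT] by blast
  qed
  have "(\<lambda>n. Y n t0) = (\<lambda>n. if n = 0 then c else 0)"
  proof
    fix n show "Y n t0 = (if n = 0 then c else 0)"
      by (cases n) (simp_all add: Y0 YS)
  qed
  then have "(\<lambda>n. Y n t0) sums c" using sums_single[of 0 "\<lambda>_. c"] by (simp add: eq_commute)
  then have "y t0 = c" using main[of t0] sums_unique2 by blast
  with main that show thesis by blast
qed

text \<open>A Gronwall argument in both directions from \<open>s\<close>:
  \<open>exp (- 2 * K * x)\<close> times the squared norm of \<open>y\<close> does not increase,
  which settles times after \<open>s\<close>, and \<open>exp (2 * K * x)\<close> times it does not
  decrease, which settles times before \<open>s\<close>.\<close>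

lemma linear_ode_zero_Icc:
  fixes y :: "real \<Rightarrow> 'a::real_inner"
  assumes y: "\<And>t. t \<in> {a..b} \<Longrightarrow> (y has_vector_derivative D t) (at t within {a..b})"
    and K: "\<And>t. t \<in> {a..b} \<Longrightarrow> norm (D t) \<le> K * norm (y t)"
    and s: "s \<in> {a..b}" "y s = 0" and t: "t \<in> {a..b}"
  shows "y t = 0"
proof -
  have ip: "\<bar>y x \<bullet> D x\<bar> \<le> K * (y x \<bullet> y x)" if "x \<in> {a..b}" for x
  proof -
    have "\<bar>y x \<bullet> D x\<bar> \<le> norm (y x) * norm (D x)" by (rule Cauchy_Schwarz_ineq2)
    also have "\<dots> \<le> norm (y x) * (K * norm (y x))" by (intro mult_left_mono K that) simp
    finally show ?thesis by (simp add: dot_square_norm power2_eq_square mult_ac)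
  qed
  have d: "((\<lambda>x. exp (c * x) * (y x \<bullet> y x)) has_vector_derivative
      exp (c * x) * (c * (y x \<bullet> y x) + 2 * (y x \<bullet> D x))) (at x within {p..q})"
    if "x \<in> {p..q}" "{p..q} \<subseteq> {a..b}" for c x p q
  proof -
    have yd: "(y has_vector_derivative D x) (at x within {p..q})"
      by (rule has_vector_derivative_within_subset[OF y]) (use that in auto)
    have "((\<lambda>x. y x \<bullet> y x) has_vector_derivative (y x \<bullet> D x + D x \<bullet> y x)) (at x within {p..q})"
      by (rule bounded_bilinear.has_vector_derivative[OF bounded_bilinear_inner yd yd])
    moreover have "((\<lambda>x. exp (c * x)) has_vector_derivative exp (c * x) * c) (at x within {p..q})"
      unfolding has_real_derivative_iff_has_vector_derivative[symmetric]
      by (auto intro!: derivative_eq_intros)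
    ultimately have "((\<lambda>x. exp (c * x) * (y x \<bullet> y x)) has_vector_derivative
      exp (c * x) * (y x \<bullet> D x + D x \<bullet> y x) + exp (c * x) * c * (y x \<bullet> y x)) (at x within {p..q})"
      by (intro has_vector_derivative_mult)
    then show ?thesis by (simp add: inner_commute algebra_simps)
  qed
  have "exp (c * t) * (y t \<bullet> y t) \<le> 0" if c: "c = (if s \<le> t then - 2 * K else 2 * K)" for c
  proof (cases "s \<le> t")
    case True
    then have sub: "{s..t} \<subseteq> {a..b}" using s t by auto
    have "- (exp (c * s) * (y s \<bullet> y s)) \<le> - (exp (c * t) * (y t \<bullet> y t))"
    proof (rule vector_derivative_nonneg_imp_mono[OF True has_vector_derivative_minus[OF d[OF _ sub]]])
      fix x assume "x \<in> {s..t}"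
      then have "\<bar>y x \<bullet> D x\<bar> \<le> K * (y x \<bullet> y x)" using sub by (intro ip) auto
      then have "c * (y x \<bullet> y x) + 2 * (y x \<bullet> D x) \<le> 0" using True c by auto
      then show "0 \<le> - (exp (c * x) * (c * (y x \<bullet> y x) + 2 * (y x \<bullet> D x)))"
        by (simp add: mult_le_0_iff)
    qed auto
    then show ?thesis using s by simp
  next
    case False
    then have ts: "t \<le> s" and sub: "{t..s} \<subseteq> {a..b}" using s t by auto
    have "exp (c * t) * (y t \<bullet> y t) \<le> exp (c * s) * (y s \<bullet> y s)"
    proof (rule vector_derivative_nonneg_imp_mono[OF ts d[OF _ sub]])
      fix x assume "x \<in> {t..s}"
      then have "\<bar>y x \<bullet> D x\<bar> \<le> K * (y x \<bullet> y x)" using sub by (intro ip) auto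
      then have "c * (y x \<bullet> y x) + 2 * (y x \<bullet> D x) \<ge> 0" using False c by auto
      then show "0 \<le> exp (c * x) * (c * (y x \<bullet> y x) + 2 * (y x \<bullet> D x))" by simp
    qed auto
    then show ?thesis using s by simp
  qed
  then have "y t \<bullet> y t \<le> 0" by (simp add: mult_le_0_iff)
  then show ?thesis by (metis inner_ge_zero inner_eq_zero_iff order_antisym)
qed

lemma linear_ode_zero:
  fixes y :: "real \<Rightarrow> 'a::real_inner"
  assumes y: "\<And>t. t \<ge> t0 \<Longrightarrow> (y has_vector_derivative D t) (at t within {t0..})"
    and bnd: "\<And>T. \<exists>K. \<forall>t\<in>{t0..T}. norm (D t) \<le> K * norm (y t)"
    and s: "s \<ge> t0" "y s = 0" and t: "t \<ge> t0"
  shows "y t = 0"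
proof -
  obtain K where "\<forall>x\<in>{t0..max s t}. norm (D x) \<le> K * norm (y x)" using bnd by blast
  then show ?thesis
    by (intro linear_ode_zero_Icc[of t0 "max s t" y D K s t])
      (use s t in \<open>auto intro!: has_vector_derivative_within_subset[OF y]\<close>)
qed

section \<open>Linear families on Euclidean spaces\<close>

lemma continuous_on_Ici_bounded:
  fixes f :: "real \<Rightarrow> 'a::real_normed_vector"
  assumes "continuous_on {t0..} f"
  shows "\<exists>K. \<forall>t\<in>{t0..T}. norm (f t) \<le> K"
proof -
  have "compact (f ` {t0..T})"
    by (rule compact_continuous_image) (auto intro: continuous_on_subset[OF assms])
  then show ?thesis using compact_imp_bounded[of "f ` {t0..T}"] unfolding bounded_iff by auto
qed

text \<open>Expanding \<open>x\<close> in the basis bounds the operator norm by the sum of the norms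
  of the images of the basis vectors, which is a continuous function of \<open>t\<close>. Pointwise
  continuity of the family is therefore enough for the existence and uniqueness results.\<close>

lemma linear_family_bound:
  fixes L :: "real \<Rightarrow> 'a::euclidean_space \<Rightarrow> 'b::real_normed_vector"
  assumes lin: "\<And>t. t \<ge> t0 \<Longrightarrow> linear (L t)"
    and cont: "\<And>x. continuous_on {t0..} (\<lambda>t. L t x)"
  shows "\<exists>K. \<forall>t\<in>{t0..T}. \<forall>x. norm (L t x) \<le> K * norm x"
proof -
  have "continuous_on {t0..} (\<lambda>t. \<Sum>b\<in>Basis. norm (L t b))"
    by (intro continuous_intros cont)
  from continuous_on_Ici_bounded[OF this, of T] obtain K
    where K: "\<And>t. t\<in>{t0..T} \<Longrightarrow> norm (\<Sum>b\<in>Basis. norm (L t b)) \<le> K" by blast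
  have "norm (L t x) \<le> K * norm x" if t: "t \<in> {t0..T}" for t x
  proof -
    interpret linear "L t" using lin t by simp
    have "L t x = L t (\<Sum>b\<in>Basis. (x \<bullet> b) *\<^sub>R b)" by (simp add: euclidean_representation)
    also have "\<dots> = (\<Sum>b\<in>Basis. (x \<bullet> b) *\<^sub>R L t b)" by (simp add: sum scale)
    finally have "norm (L t x) \<le> (\<Sum>b\<in>Basis. norm ((x \<bullet> b) *\<^sub>R L t b))" by (simp only: norm_sum)
    also have "\<dots> \<le> (\<Sum>b\<in>Basis. norm x * norm (L t b))"
      by (intro sum_mono) (simp add: mult_right_mono Basis_le_norm)
    also have "\<dots> = norm x * (\<Sum>b\<in>Basis. norm (L t b))" by (simp add: sum_distrib_left)
    also have "\<dots> \<le> norm x * K" using K[OF t] by (intro mult_left_mono) auto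
    finally show ?thesis by (simp add: mult.commute)
  qed
  then show ?thesis by blast
qed

lemma linear_family_continuous:
  fixes L :: "real \<Rightarrow> 'a::euclidean_space \<Rightarrow> 'b::real_normed_vector"
  assumes lin: "\<And>t. t \<ge> t0 \<Longrightarrow> linear (L t)"
    and cont: "\<And>x. continuous_on {t0..} (\<lambda>t. L t x)"
    and y: "continuous_on {t0..} y"
  shows "continuous_on {t0..} (\<lambda>t. L t (y t))"
proof -
  have "L t (y t) = (\<Sum>b\<in>Basis. (y t \<bullet> b) *\<^sub>R L t b)" if "t \<ge> t0" for t
  proof -
    interpret linear "L t" using lin that by simp
    have "L t (y t) = L t (\<Sum>b\<in>Basis. (y t \<bullet> b) *\<^sub>R b)" by (simp add: euclidean_representation)
    also have "\<dots> = (\<Sum>b\<in>Basis. (y t \<bullet> b) *\<^sub>R L t b)" by (simp add: sum scale)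
    finally show ?thesis .
  qed
  moreover have "continuous_on {t0..} (\<lambda>t. \<Sum>b\<in>Basis. (y t \<bullet> b) *\<^sub>R L t b)"
    by (intro continuous_intros cont y)
  ultimately show ?thesis by (subst continuous_on_cong[OF refl, of _ _ "\<lambda>t. \<Sum>b\<in>Basis. (y t \<bullet> b) *\<^sub>R L t b"]) auto
qed

lemma linear_ode_solution:
  fixes L :: "real \<Rightarrow> 'a::euclidean_space \<Rightarrow> 'a"
  assumes lin: "\<And>t. t \<ge> t0 \<Longrightarrow> linear (L t)"
    and cont: "\<And>x. continuous_on {t0..} (\<lambda>t. L t x)"
    and b: "continuous_on {t0..} b"
  shows "\<exists>y. y t0 = c \<and>
    (\<forall>t\<ge>t0. (y has_vector_derivative (L t (y t) + b t)) (at t within {t0..}))"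
  using linear_ode_exists[OF lin linear_family_bound[OF lin cont]
      linear_family_continuous[OF lin cont] b] by blast

lemma linear_ode_unique:
  fixes L :: "real \<Rightarrow> 'a::euclidean_space \<Rightarrow> 'a"
  assumes lin: "\<And>t. t \<ge> t0 \<Longrightarrow> linear (L t)"
    and cont: "\<And>x. continuous_on {t0..} (\<lambda>t. L t x)"
    and y: "\<And>t. t \<ge> t0 \<Longrightarrow> (y has_vector_derivative (L t (y t))) (at t within {t0..})"
    and s: "s \<ge> t0" "y s = 0" and t: "t \<ge> t0"
  shows "y t = 0"
  by (rule linear_ode_zero[OF y _ s t]) (use linear_family_bound[OF lin cont] in blast)+

section \<open>Complex matrices and Hamiltonian systems\<close>

lemma bounded_bilinear_matrix_mult:
  "bounded_bilinear ((**) :: complex^'n^'m \<Rightarrow> complex^'p^'n \<Rightarrow> complex^'p^'m)"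
  unfolding bilinear_conv_bounded_bilinear[symmetric] bilinear_def linear_iff
  by (auto simp: matrix_matrix_mult_def vec_eq_iff sum.distrib algebra_simps scaleR_sum_right)

lemma bounded_bilinear_matrix_vector_mult:
  "bounded_bilinear ((*v) :: complex^'n^'m \<Rightarrow> complex^'n \<Rightarrow> complex^'m)"
  unfolding bilinear_conv_bounded_bilinear[symmetric] bilinear_def linear_iff
  by (auto simp: matrix_vector_mult_def vec_eq_iff sum.distrib algebra_simps scaleR_sum_right)

lemma bounded_linear_cadj: "bounded_linear (cadj :: complex^'n^'n \<Rightarrow> _)"
  unfolding linear_conv_bounded_linear[symmetric] linear_iff
  by (auto simp: cadj_def vec_eq_iff)

lemmas has_vector_derivative_matrix_mult =
  bounded_bilinear.has_vector_derivative[OF bounded_bilinear_matrix_mult]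
lemmas has_vector_derivative_matrix_vector_mult =
  bounded_bilinear.has_vector_derivative[OF bounded_bilinear_matrix_vector_mult]
lemmas has_vector_derivative_cadj =
  bounded_linear.has_vector_derivative[OF bounded_linear_cadj]
lemmas has_vector_derivative_vec_nth =
  bounded_linear.has_vector_derivative[OF bounded_linear_vec_nth]
lemmas continuous_on_matrix_mult [continuous_intros] =
  bounded_bilinear.continuous_on[OF bounded_bilinear_matrix_mult]
lemmas continuous_on_matrix_vector_mult [continuous_intros] =
  bounded_bilinear.continuous_on[OF bounded_bilinear_matrix_vector_mult]
lemmas continuous_on_cadj [continuous_intros] =
  bounded_linear.continuous_on[OF bounded_linear_cadj]

lemma has_vector_derivative_matrix_entry:
  assumes "(X has_vector_derivative X') F"
  shows "((\<lambda>t. X t $ i $ j) has_vector_derivative X' $ i $ j) F"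
  by (intro has_vector_derivative_vec_nth assms)

lemmas matrix_mult_algebra =
  bounded_bilinear.add_left[OF bounded_bilinear_matrix_mult]
  bounded_bilinear.add_right[OF bounded_bilinear_matrix_mult]
  bounded_bilinear.diff_left[OF bounded_bilinear_matrix_mult]
  bounded_bilinear.diff_right[OF bounded_bilinear_matrix_mult]
  bounded_bilinear.minus_left[OF bounded_bilinear_matrix_mult]
  bounded_bilinear.minus_right[OF bounded_bilinear_matrix_mult]
  matrix_mul_assoc[symmetric]

lemmas matrix_vector_algebra =
  bounded_bilinear.add_left[OF bounded_bilinear_matrix_vector_mult]
  bounded_bilinear.add_right[OF bounded_bilinear_matrix_vector_mult]
  bounded_bilinear.diff_left[OF bounded_bilinear_matrix_vector_mult]
  bounded_bilinear.diff_right[OF bounded_bilinear_matrix_vector_mult]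
  bounded_bilinear.minus_left[OF bounded_bilinear_matrix_vector_mult]
  bounded_bilinear.minus_right[OF bounded_bilinear_matrix_vector_mult]
  bounded_bilinear.zero_right[OF bounded_bilinear_matrix_vector_mult]
  bounded_bilinear.zero_left[OF bounded_bilinear_matrix_vector_mult]
  matrix_vector_mul_assoc[symmetric]

lemma cadj_cadj [simp]: "cadj (cadj M) = M"
  by (simp add: cadj_def vec_eq_iff)

lemma cadj_mult: "cadj (M ** N) = cadj N ** cadj M"
  by (simp add: cadj_def vec_eq_iff matrix_matrix_mult_def mult.commute)

lemmas cadj_linear = bounded_linear.linear[OF bounded_linear_cadj, THEN linear_add]
  bounded_linear.linear[OF bounded_linear_cadj, THEN linear_diff]
  bounded_linear.linear[OF bounded_linear_cadj, THEN linear_neg]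
  bounded_linear.linear[OF bounded_linear_cadj, THEN linear_0]

lemma cadj_mat [simp]: "cadj (mat c) = mat (cnj c)"
  by (simp add: cadj_def mat_def vec_eq_iff)

lemma inner_complex_eq_Re: "x \<bullet> y = Re (cnj x * y)" for x y :: complex
  by (simp add: inner_complex_def)

text \<open>The inner product on complex vectors is real, namely the real part of the Hermitian
  form. The conjugate transpose is the adjoint for it as well.\<close>

lemma inner_cadj: "(M *v x) \<bullet> y = x \<bullet> (cadj M *v y)"
proof -
  have "(M *v x) \<bullet> y = Re (\<Sum>i\<in>UNIV. \<Sum>j\<in>UNIV. cnj (M$i$j) * cnj (x$j) * y$i)"
    by (simp add: inner_vec_def inner_complex_eq_Re matrix_vector_mult_def sum_distrib_right)
  also have "\<dots> = Re (\<Sum>j\<in>UNIV. \<Sum>i\<in>UNIV. cnj (M$i$j) * cnj (x$j) * y$i)"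
    by (subst sum.swap) simp
  also have "\<dots> = x \<bullet> (cadj M *v y)"
    by (simp add: inner_vec_def inner_complex_eq_Re matrix_vector_mult_def cadj_def sum_distrib_left mult_ac)
  finally show ?thesis .
qed

text \<open>Liouville's formula for a two-sided linear equation. The factor on the right serves the
  equation of the square root; \<open>N = mat 0\<close> gives the usual one-sided case.\<close>

lemma has_vector_derivative_det2:
  fixes X :: "real \<Rightarrow> complex^2^2" and M N :: "complex^2^2"
  assumes "(X has_vector_derivative (M ** X t + X t ** N)) (at t within A)"
  shows "((\<lambda>t. det (X t)) has_vector_derivative (trace M + trace N) * det (X t)) (at t within A)"
proof -
  note d = has_vector_derivative_matrix_entry[OF assms]
  show ?thesis unfolding det_2
    by (rule has_vector_derivative_eq_rhs[OF has_vector_derivative_diff[OF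
      has_vector_derivative_mult[OF d d] has_vector_derivative_mult[OF d d]]])
      (simp add: matrix_matrix_mult_def sum_2 trace_def algebra_simps)
qed

lemma det_eq_0_iff_kernel:
  fixes M :: "'a::field^'n^'n"
  shows "det M = 0 \<longleftrightarrow> (\<exists>c. c \<noteq> 0 \<and> M *v c = 0)"
  using invertible_det_nz[of M] matrix_left_invertible_ker[of M] invertible_left_inverse[of M] by blast

text \<open>The pair of unknown matrices is treated as one unknown in the product space, where the
  system is a homogeneous linear equation.\<close>

lemma ham_matrix_solution_exists:
  assumes A: "continuous_on {t0..} A" and B: "continuous_on {t0..} B" and C: "continuous_on {t0..} C"
  obtains \<Phi> \<Psi> where "ham_matrix_solution A B C t0 \<Phi> \<Psi>" "\<Phi> t0 = \<Phi>0" "\<Psi> t0 = \<Psi>0"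
proof -
  define L where "L t z = (A t ** fst z + B t ** snd z, C t ** fst z - cadj (A t) ** snd z)"
    for t and z :: "(complex^2^2) \<times> (complex^2^2)"
  have lin: "linear (L t)" for t
    unfolding L_def linear_iff
    by (auto simp: matrix_mult_algebra bounded_bilinear.scaleR_right[OF bounded_bilinear_matrix_mult] algebra_simps)
  have cont: "continuous_on {t0..} (\<lambda>t. L t x)" for x
    unfolding L_def by (intro continuous_intros A B C)
  have "\<exists>y. y t0 = (\<Phi>0, \<Psi>0) \<and>
      (\<forall>t\<ge>t0. (y has_vector_derivative (L t (y t) + 0)) (at t within {t0..}))"
    using linear_ode_solution[of t0 L "\<lambda>_. 0" "(\<Phi>0, \<Psi>0)"] lin cont by simp
  then obtain y where y: "y t0 = (\<Phi>0, \<Psi>0)"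
    "\<And>t. t \<ge> t0 \<Longrightarrow> (y has_vector_derivative (L t (y t))) (at t within {t0..})" by auto
  have "ham_matrix_solution A B C t0 (\<lambda>t. fst (y t)) (\<lambda>t. snd (y t))"
    unfolding ham_matrix_solution_def
  proof (intro allI impI)
    fix t assume "t \<ge> t0"
    then have d: "(y has_vector_derivative (L t (y t))) (at t within {t0..})" by (rule y(2))
    have "((\<lambda>t. fst (y t)) has_vector_derivative fst (L t (y t))) (at t within {t0..})"
      by (rule bounded_linear.has_vector_derivative[OF bounded_linear_fst d])
    moreover have "((\<lambda>t. snd (y t)) has_vector_derivative snd (L t (y t))) (at t within {t0..})"
      by (rule bounded_linear.has_vector_derivative[OF bounded_linear_snd d])
    ultimately show "((\<lambda>t. fst (y t)) has_vector_derivative A t ** fst (y t) + B t ** snd (y t)) (at t within {t0..}) \<and>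
      ((\<lambda>t. snd (y t)) has_vector_derivative C t ** fst (y t) - cadj (A t) ** snd (y t)) (at t within {t0..})"
      unfolding L_def fst_conv snd_conv by blast
  qed
  with y(1) show thesis by (intro that[of "\<lambda>t. fst (y t)" "\<lambda>t. snd (y t)"]) auto
qed

text \<open>Since \<open>B\<close> and \<open>C\<close> are Hermitian, the terms in the derivative
  of the Wronskian \<open>?W\<close> cancel, so that its initial value zero persists.\<close>

lemma ham_matrix_solution_conjoined:
  assumes sol: "ham_matrix_solution A B C t0 \<Phi> \<Psi>"
    and B: "\<And>t. t \<ge> t0 \<Longrightarrow> cadj (B t) = B t" and C: "\<And>t. t \<ge> t0 \<Longrightarrow> cadj (C t) = C t"
    and init: "cadj (\<Phi> t0) ** \<Psi> t0 = cadj (\<Psi> t0) ** \<Phi> t0"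
  shows "conjoined t0 \<Phi> \<Psi>"
  unfolding conjoined_def
proof (intro allI impI)
  fix t assume t: "t \<ge> t0"
  let ?W = "\<lambda>t. cadj (\<Phi> t) ** \<Psi> t - cadj (\<Psi> t) ** \<Phi> t"
  have "(?W has_vector_derivative 0) (at s within {t0..})" if s: "s \<ge> t0" for s
  proof -
    note d = sol[unfolded ham_matrix_solution_def, rule_format, OF s]
    show ?thesis
      by (rule has_vector_derivative_eq_rhs[OF has_vector_derivative_diff[OF
        has_vector_derivative_matrix_mult[OF has_vector_derivative_cadj[OF conjunct1[OF d]] conjunct2[OF d]]
        has_vector_derivative_matrix_mult[OF has_vector_derivative_cadj[OF conjunct2[OF d]] conjunct1[OF d]]]])
       (simp add: matrix_mult_algebra cadj_linear cadj_mult B[OF s] C[OF s])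
  qed
  then have "?W t = 0"
    by (rule linear_ode_zero[of t0 ?W "\<lambda>_. 0" t0]) (use init t in \<open>auto intro!: exI[of _ 0]\<close>)
  then show "cadj (\<Phi> t) ** \<Psi> t = cadj (\<Psi> t) ** \<Phi> t" by simp
qed

section \<open>The square root of a nonnegative 2 by 2 matrix\<close>

lemma nonneg_def_inner: "nonneg_def M \<longleftrightarrow> cadj M = M \<and> (\<forall>v. 0 \<le> v \<bullet> (M *v v))"
  by (simp add: nonneg_def_def inner_vec_def inner_complex_eq_Re)

text \<open>Coordinates on Hermitian matrices with an explicitly real diagonal; nonnegativity and
  squaring become scalar relations in them.\<close>

definition herm2 :: "real \<Rightarrow> complex \<Rightarrow> real \<Rightarrow> complex^2^2" where
  "herm2 a z b = (\<chi> i j. if i = 1 then if j = 1 then of_real a else z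
                             else if j = 1 then cnj z else of_real b)"

lemma herm2_entries [simp]:
  "herm2 a z b $ 1 $ 1 = of_real a" "herm2 a z b $ 1 $ 2 = z"
  "herm2 a z b $ 2 $ 1 = cnj z" "herm2 a z b $ 2 $ 2 = of_real b"
  by (simp_all add: herm2_def)

lemma matrix2_eq_iff:
  "(M :: 'a^2^2) = N \<longleftrightarrow> M$1$1 = N$1$1 \<and> M$1$2 = N$1$2 \<and> M$2$1 = N$2$1 \<and> M$2$2 = N$2$2"
  by (auto simp: vec_eq_iff forall_2)

lemma cadj_herm2 [simp]: "cadj (herm2 a z b) = herm2 a z b"
  by (simp add: matrix2_eq_iff cadj_def)

lemma hermitian_imp_herm2:
  assumes "cadj M = M"
  shows "M = herm2 (Re (M$1$1)) (M$1$2) (Re (M$2$2))"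
proof -
  have "cnj (M$1$1) = M$1$1" "cnj (M$2$2) = M$2$2" "cnj (M$1$2) = M$2$1"
    using assms by (auto simp: matrix2_eq_iff cadj_def)
  then show ?thesis by (auto simp: matrix2_eq_iff complex_eq_iff)
qed

lemma inner_herm2:
  "v \<bullet> (herm2 a z b *v v) = a * (cmod (v$1))\<^sup>2 + b * (cmod (v$2))\<^sup>2 + 2 * Re (cnj (v$1) * z * v$2)"
  unfolding cmod_power2
  by (simp add: inner_vec_def inner_complex_eq_Re matrix_vector_mult_def sum_2 power2_eq_square algebra_simps)

text \<open>Necessity comes from test vectors: the unit vectors give the diagonal, while
  \<open>(- z, a)\<close> and \<open>(b, - cnj z)\<close> give the determinant multiplied by
  \<open>a\<close> and by \<open>b\<close>. If both diagonal entries vanish, \<open>(- z, 1)\<close>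
  forces \<open>z = 0\<close>. Sufficiency is the arithmetic-geometric mean inequality.\<close>

lemma nonneg_def_herm2_iff:
  "nonneg_def (herm2 a z b) \<longleftrightarrow> 0 \<le> a \<and> 0 \<le> b \<and> (cmod z)\<^sup>2 \<le> a * b"
proof
  assume n: "nonneg_def (herm2 a z b)"
  have v: "0 \<le> a * (cmod x)\<^sup>2 + b * (cmod y)\<^sup>2 + 2 * Re (cnj x * z * y)" for x y
  proof -
    have "0 \<le> (\<chi> i. if i = 1 then x else y) \<bullet> (herm2 a z b *v (\<chi> i. if i = 1 then x else y))"
      using n by (simp only: nonneg_def_inner)
    then show ?thesis unfolding inner_herm2 by simp
  qed
  have a: "0 \<le> a" using v[of 1 0] by simp
  have b: "0 \<le> b" using v[of 0 1] by simp
  have za: "0 \<le> a * (a * b - (cmod z)\<^sup>2)"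
    using v[of "- z" "of_real a"] unfolding cmod_power2
    by (simp add: power2_eq_square algebra_simps)
  have zb: "0 \<le> b * (a * b - (cmod z)\<^sup>2)"
    using v[of "of_real b" "- cnj z"] unfolding cmod_power2
    by (simp add: power2_eq_square algebra_simps)
  have "(cmod z)\<^sup>2 \<le> 0" if "a = 0" "b = 0"
    using v[of "- z" 1] that unfolding cmod_power2 by (simp add: power2_eq_square)
  with a b za zb show "0 \<le> a \<and> 0 \<le> b \<and> (cmod z)\<^sup>2 \<le> a * b"
    by (metis diff_ge_0_iff_ge mult.commute mult_zero_left order_le_less zero_le_mult_iff not_le)
next
  assume h: "0 \<le> a \<and> 0 \<le> b \<and> (cmod z)\<^sup>2 \<le> a * b"
  have "0 \<le> v \<bullet> (herm2 a z b *v v)" for v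
  proof -
    define x y where "x = cmod (v$1)" and "y = cmod (v$2)"
    have "cmod z \<le> sqrt a * sqrt b"
      using h by (metis real_le_rsqrt real_sqrt_mult)
    then have "x * cmod z * y \<le> x * (sqrt a * sqrt b) * y"
      by (intro mult_right_mono mult_left_mono) (auto simp: x_def y_def)
    moreover have "- Re (cnj (v$1) * z * v$2) \<le> x * cmod z * y"
      using abs_Re_le_cmod[of "cnj (v$1) * z * v$2"] by (simp add: x_def y_def norm_mult)
    moreover have "0 \<le> (sqrt a * x - sqrt b * y)\<^sup>2" by simp
    moreover have "(sqrt a * x - sqrt b * y)\<^sup>2 = a * x\<^sup>2 + b * y\<^sup>2 - 2 * (x * (sqrt a * sqrt b) * y)"
      using h by (simp add: power2_diff power_mult_distrib algebra_simps)
    ultimately show ?thesis unfolding inner_herm2 x_def[symmetric] y_def[symmetric] by linarith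
  qed
  then show "nonneg_def (herm2 a z b)" by (simp add: nonneg_def_inner)
qed

lemma herm2_square:
  "herm2 p w q ** herm2 p w q = herm2 a z b \<longleftrightarrow>
    p\<^sup>2 + (cmod w)\<^sup>2 = a \<and> q\<^sup>2 + (cmod w)\<^sup>2 = b \<and> of_real (p + q) * w = z"
proof -
  have cnj_w: "w * cnj w = of_real ((cmod w)\<^sup>2)"
    by (rule complex_norm_square[symmetric])
  have "(herm2 p w q ** herm2 p w q) $ i $ j =
      herm2 (p\<^sup>2 + (cmod w)\<^sup>2) (of_real (p + q) * w) (q\<^sup>2 + (cmod w)\<^sup>2) $ i $ j" for i j
  proof -
    have "(herm2 p w q ** herm2 p w q) $ 1 $ 1 = of_real (p\<^sup>2) + w * cnj w"
      "(herm2 p w q ** herm2 p w q) $ 2 $ 2 = of_real (q\<^sup>2) + w * cnj w"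
      "(herm2 p w q ** herm2 p w q) $ 1 $ 2 = of_real (p + q) * w"
      "(herm2 p w q ** herm2 p w q) $ 2 $ 1 = of_real (p + q) * cnj w"
      by (simp_all add: matrix_matrix_mult_def sum_2 power2_eq_square algebra_simps)
    then show ?thesis
      unfolding cnj_w using exhaust_2[of i] exhaust_2[of j] by auto
  qed
  then have "herm2 p w q ** herm2 p w q = herm2 (p\<^sup>2 + (cmod w)\<^sup>2) (of_real (p + q) * w) (q\<^sup>2 + (cmod w)\<^sup>2)"
    by (simp add: vec_eq_iff)
  moreover have "herm2 a' z' b' = herm2 a z b \<longleftrightarrow> a' = a \<and> b' = b \<and> z' = z" for a' z' b'
    unfolding matrix2_eq_iff herm2_entries by auto
  ultimately show ?thesis by simp
qed

text \<open>Determinant and trace of a nonnegative root are determined by its square: the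
  determinant is the nonnegative root of the determinant of the square, and the squared trace is the
  trace of the square plus twice the determinant. Trace times root is then the square plus a
  multiple of the identity, which recovers the root unless the trace vanishes; in that case the root
  is zero.\<close>

lemma nonneg_sqrt_unique:
  fixes S S' :: "complex^2^2"
  assumes "nonneg_def S" "nonneg_def S'" "S ** S = S' ** S'"
  shows "S = S'"
proof -
  obtain p w q where S: "S = herm2 p w q"
    using hermitian_imp_herm2[of S] assms(1) by (auto simp: nonneg_def_def)
  obtain p' w' q' where S': "S' = herm2 p' w' q'"
    using hermitian_imp_herm2[of S'] assms(2) by (auto simp: nonneg_def_def)
  have n: "0 \<le> p" "0 \<le> q" "(cmod w)\<^sup>2 \<le> p * q" and n': "0 \<le> p'" "0 \<le> q'" "(cmod w')\<^sup>2 \<le> p' * q'"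
    using assms by (auto simp: S S' nonneg_def_herm2_iff)
  have "herm2 p' w' q' ** herm2 p' w' q' =
      herm2 (p\<^sup>2 + (cmod w)\<^sup>2) (of_real (p + q) * w) (q\<^sup>2 + (cmod w)\<^sup>2)"
    using assms(3) herm2_square[of p w q] by (simp add: S S')
  then have e: "p'\<^sup>2 + (cmod w')\<^sup>2 = p\<^sup>2 + (cmod w)\<^sup>2" "q'\<^sup>2 + (cmod w')\<^sup>2 = q\<^sup>2 + (cmod w)\<^sup>2"
    "of_real (p' + q') * w' = of_real (p + q) * w"
    unfolding herm2_square by auto
  define \<tau> \<tau>' where "\<tau> = p + q" and "\<tau>' = p' + q'"
  have "cmod (of_real \<tau>' * w') = cmod (of_real \<tau> * w)" using e(3) by (simp add: \<tau>_def \<tau>'_def)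
  then have e3: "\<tau>' * cmod w' = \<tau> * cmod w"
    using n n' unfolding norm_mult norm_of_real by (simp add: \<tau>_def \<tau>'_def)
  \<comment> \<open>Multiplicativity of the determinant, in coordinates.\<close>
  have sq: "(p * q - (cmod w)\<^sup>2)\<^sup>2 = (p\<^sup>2 + (cmod w)\<^sup>2) * (q\<^sup>2 + (cmod w)\<^sup>2) - ((p + q) * cmod w)\<^sup>2" for p q w
    by (simp add: power2_eq_square algebra_simps)
  have "(p * q - (cmod w)\<^sup>2)\<^sup>2 = (p' * q' - (cmod w')\<^sup>2)\<^sup>2"
    unfolding sq e(1,2) using e3 by (simp add: \<tau>_def \<tau>'_def)
  then have d: "p * q - (cmod w)\<^sup>2 = p' * q' - (cmod w')\<^sup>2"
    by (rule power2_eq_imp_eq) (use n n' in auto)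
  have "\<tau>\<^sup>2 = \<tau>'\<^sup>2" using d e(1,2) by (simp add: \<tau>_def \<tau>'_def power2_sum)
  then have t: "\<tau> = \<tau>'" by (rule power2_eq_imp_eq) (use n n' in \<open>auto simp: \<tau>_def \<tau>'_def\<close>)
  show ?thesis
  proof (cases "\<tau> = 0")
    case True
    then have "p = 0" "q = 0" "p' = 0" "q' = 0" using n n' t by (auto simp: \<tau>_def \<tau>'_def)
    then show ?thesis using n n' by (simp add: S S')
  next
    case False
    have w: "w = w'" using e(3) t False by (simp add: \<tau>_def \<tau>'_def flip: of_real_add)
    have "\<tau> * p = \<tau>' * p'" "\<tau> * q = \<tau>' * q'"
      using d e(1,2) by (simp_all add: \<tau>_def \<tau>'_def power2_eq_square algebra_simps)
    then show ?thesis using w t False by (simp add: S S')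
  qed
qed

text \<open>By Cayley-Hamilton the root is \<open>M\<close> plus \<open>d\<close> times the
  identity, divided by \<open>\<tau>\<close>, where \<open>d\<close> is the root of the determinant
  of \<open>M\<close> and \<open>\<tau>\<close> becomes the trace of the result.\<close>

lemma nonneg_sqrt_exists:
  fixes M :: "complex^2^2"
  assumes "nonneg_def M"
  shows "\<exists>S. nonneg_def S \<and> S ** S = M"
proof -
  obtain a z b where M: "M = herm2 a z b"
    using hermitian_imp_herm2[of M] assms by (auto simp: nonneg_def_def)
  have n: "0 \<le> a" "0 \<le> b" "(cmod z)\<^sup>2 \<le> a * b"
    using assms by (auto simp: M nonneg_def_herm2_iff)
  define d where "d = sqrt (a * b - (cmod z)\<^sup>2)"
  define \<tau> where "\<tau> = sqrt (a + b + 2 * d)"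
  have d: "d \<ge> 0" "d\<^sup>2 = a * b - (cmod z)\<^sup>2" using n by (auto simp: d_def)
  have t: "\<tau> \<ge> 0" "\<tau>\<^sup>2 = a + b + 2 * d" using n d by (auto simp: \<tau>_def)
  show ?thesis
  proof (cases "\<tau> = 0")
    case True
    then have "a = 0" "b = 0" using t n d by auto
    then have "M = herm2 0 0 0" using n by (simp add: M)
    then show ?thesis
      by (intro exI[of _ "herm2 0 0 0"]) (simp add: nonneg_def_herm2_iff herm2_square)
  next
    case False
    then have tp: "\<tau> > 0" using t by simp
    have z2: "(cmod z)\<^sup>2 = a * b - d\<^sup>2" using d by simp
    have a1: "((a + d) / \<tau>)\<^sup>2 + (cmod (z / of_real \<tau>))\<^sup>2 = a"
    proof -
      have "((a + d) / \<tau>)\<^sup>2 + (cmod (z / of_real \<tau>))\<^sup>2 = ((a + d)\<^sup>2 + (cmod z)\<^sup>2) / \<tau>\<^sup>2"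
        unfolding norm_divide power_divide norm_of_real power2_abs by (rule add_divide_distrib[symmetric])
      also have "(a + d)\<^sup>2 + (cmod z)\<^sup>2 = a * \<tau>\<^sup>2" unfolding z2 t by (simp add: power2_eq_square algebra_simps)
      finally show ?thesis using tp by simp
    qed
    have a2: "((b + d) / \<tau>)\<^sup>2 + (cmod (z / of_real \<tau>))\<^sup>2 = b"
    proof -
      have "((b + d) / \<tau>)\<^sup>2 + (cmod (z / of_real \<tau>))\<^sup>2 = ((b + d)\<^sup>2 + (cmod z)\<^sup>2) / \<tau>\<^sup>2"
        unfolding norm_divide power_divide norm_of_real power2_abs by (rule add_divide_distrib[symmetric])
      also have "(b + d)\<^sup>2 + (cmod z)\<^sup>2 = b * \<tau>\<^sup>2" unfolding z2 t by (simp add: power2_eq_square algebra_simps)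
      finally show ?thesis using tp by simp
    qed
    have "(a + d) / \<tau> + (b + d) / \<tau> = \<tau>"
    proof -
      have "(a + d) / \<tau> + (b + d) / \<tau> = \<tau>\<^sup>2 / \<tau>"
        unfolding t(2) add_divide_distrib[symmetric] by simp
      then show ?thesis using tp by (simp add: power2_eq_square)
    qed
    then have a3: "of_real ((a + d) / \<tau> + (b + d) / \<tau>) * (z / of_real \<tau>) = z" using tp by simp
    have "nonneg_def (herm2 ((a + d) / \<tau>) (z / of_real \<tau>) ((b + d) / \<tau>))"
    proof -
      have "(cmod z)\<^sup>2 \<le> (a + d) * (b + d)" using n d by (simp add: algebra_simps add_increasing2)
      then have "(cmod z)\<^sup>2 / \<tau>\<^sup>2 \<le> (a + d) * (b + d) / \<tau>\<^sup>2" by (rule divide_right_mono) simp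
      then show ?thesis
        using n d tp by (simp add: nonneg_def_herm2_iff norm_divide power_divide power2_eq_square)
    qed
    moreover have "herm2 ((a + d) / \<tau>) (z / of_real \<tau>) ((b + d) / \<tau>) **
        herm2 ((a + d) / \<tau>) (z / of_real \<tau>) ((b + d) / \<tau>) = M"
      unfolding M using a1 a2 a3 by (simp only: herm2_square simp_thms)
    ultimately show ?thesis by blast
  qed
qed

lemma msqrt_nonneg_square:
  fixes M :: "complex^2^2"
  assumes "nonneg_def M"
  shows "nonneg_def (msqrt M)" "msqrt M ** msqrt M = M"
proof -
  have "\<exists>!S. nonneg_def S \<and> S ** S = M"
    using nonneg_sqrt_exists[OF assms] nonneg_sqrt_unique by metis
  from theI'[OF this] show "nonneg_def (msqrt M)" "msqrt M ** msqrt M = M"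
    unfolding msqrt_def by blast+
qed

section \<open>Scalar Riccati inequalities\<close>

lemma exp_integral_has_vector_derivative:
  fixes g :: "real \<Rightarrow> 'a::{banach,real_normed_field}"
  assumes "continuous_on {a..b} g" "t \<in> {a..b}"
  shows "((\<lambda>t. exp (integral {a..t} g)) has_vector_derivative g t * exp (integral {a..t} g)) (at t within {a..b})"
proof -
  have "(exp \<circ> (\<lambda>t. integral {a..t} g) has_vector_derivative g t * exp (integral {a..t} g)) (at t within {a..b})"
    by (rule field_vector_diff_chain_within[OF integral_has_vector_derivative[OF assms]])
      (rule DERIV_exp[THEN DERIV_subset], simp)
  then show ?thesis by (simp add: comp_def)
qed

lemma continuous_on_integral_Icc:
  fixes f :: "real \<Rightarrow> 'a::banach"
  assumes "continuous_on {a..b} f"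
  shows "continuous_on {a..b} (\<lambda>t. integral {a..t} f)"
  by (rule has_vector_derivative_imp_continuous_on)
    (use integral_has_vector_derivative[OF assms] in auto)

text \<open>With the integrating factor \<open>exp (integral {a..t} g)\<close> the inequality says
  that the product does not decrease. It is used both to preserve signs and to keep a determinant
  away from zero.\<close>

lemma linear_differential_inequality:
  fixes D :: "real \<Rightarrow> real"
  assumes "a \<le> b" and g: "continuous_on {a..b} g"
    and D: "\<And>t. t \<in> {a..b} \<Longrightarrow> (D has_vector_derivative D' t) (at t within {a..b})"
    and ineq: "\<And>t. t \<in> {a..b} \<Longrightarrow> D' t \<ge> - g t * D t"
  shows "D a \<le> exp (integral {a..b} g) * D b"
proof -
  have "exp (integral {a..a} g) * D a \<le> exp (integral {a..b} g) * D b"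
  proof (rule vector_derivative_nonneg_imp_mono[OF assms(1)])
    fix t assume t: "t \<in> {a..b}"
    show "((\<lambda>t. exp (integral {a..t} g) * D t) has_vector_derivative
        (exp (integral {a..t} g) * D' t + g t * exp (integral {a..t} g) * D t)) (at t within {a..b})"
      by (rule has_vector_derivative_mult[OF exp_integral_has_vector_derivative[OF g t] D[OF t]])
    have "0 \<le> exp (integral {a..t} g) * (D' t + g t * D t)" using ineq[OF t] by simp
    then show "0 \<le> exp (integral {a..t} g) * D' t + g t * exp (integral {a..t} g) * D t"
      by (simp add: algebra_simps)
  qed
  then show ?thesis by simp
qed

lemma integral_Icc_diff:
  fixes f :: "real \<Rightarrow> 'a::banach"
  assumes "continuous_on {a..b} f" "a \<le> \<tau>" "\<tau> \<le> t" "t \<le> b"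
  shows "integral {\<tau>..t} f = integral {a..t} f - integral {a..\<tau>} f"
proof -
  have "f integrable_on {a..t}"
    by (rule integrable_continuous_real[OF continuous_on_subset[OF assms(1)]]) (use assms in auto)
  from Henstock_Kurzweil_Integration.integral_combine[OF assms(2,3) this] show ?thesis by (simp add: algebra_simps)
qed

text \<open>Splitting the kernel into a factor in \<open>t\<close> and a factor in
  \<open>\<tau>\<close> removes \<open>t\<close> from under the integral, so that the function can
  be differentiated in \<open>t\<close>.\<close>

lemma Itil_eq:
  assumes \<rho>: "continuous_on {a..b} \<rho>" and t: "t \<in> {a..b}"
  shows "Itil \<rho> chi a t = exp (- integral {a..t} (\<lambda>s. 2 * \<rho> s)) *
    integral {a..t} (\<lambda>\<tau>. exp (integral {a..\<tau>} (\<lambda>s. 2 * \<rho> s)) * chi \<tau>)"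
proof -
  have c: "continuous_on {a..b} (\<lambda>s. 2 * \<rho> s)" by (intro continuous_intros \<rho>)
  have "Itil \<rho> chi a t = integral {a..t} (\<lambda>\<tau>. exp (- integral {a..t} (\<lambda>s. 2 * \<rho> s)) *
      (exp (integral {a..\<tau>} (\<lambda>s. 2 * \<rho> s)) * chi \<tau>))"
    unfolding Itil_def
  proof (rule Henstock_Kurzweil_Integration.integral_cong)
    fix \<tau> assume "\<tau> \<in> {a..t}"
    then have "integral {\<tau>..t} (\<lambda>s. 2 * \<rho> s) = integral {a..t} (\<lambda>s. 2 * \<rho> s) - integral {a..\<tau>} (\<lambda>s. 2 * \<rho> s)"
      using integral_Icc_diff[OF c, of \<tau> t] t by simp
    then show "exp (- integral {\<tau>..t} (\<lambda>s. 2 * \<rho> s)) * chi \<tau> =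
      exp (- integral {a..t} (\<lambda>s. 2 * \<rho> s)) * (exp (integral {a..\<tau>} (\<lambda>s. 2 * \<rho> s)) * chi \<tau>)"
      by (simp only: mult.assoc[symmetric] exp_add[symmetric]) simp
  qed
  then show ?thesis by simp
qed

text \<open>The iterate \<open>- Itil\<close> solves \<open>\<zeta>\<^sub>0' = - 2 \<rho> \<zeta>\<^sub>0 - chi\<close>, and the integral condition says that the solution
  of \<open>\<zeta>' = - (2 \<rho> + \<zeta>\<^sub>0) \<zeta> - chi\<close> with \<open>\<zeta> a = 0\<close> is nonnegative. Then \<open>\<zeta> \<le> \<zeta>\<^sub>0\<close>, which makes \<open>\<zeta>\<close> a
  subsolution of the Riccati equation.\<close>

lemma riccati_supersolution_positive:
  fixes \<rho> chi z :: "real \<Rightarrow> real"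
  assumes ab: "a \<le> b" and \<rho>: "continuous_on {a..b} \<rho>" and chi: "continuous_on {a..b} chi"
    and K: "\<And>t. a \<le> t \<Longrightarrow> t < b \<Longrightarrow>
      integral {a..t} (\<lambda>\<tau>. exp (integral {a..\<tau>} (\<lambda>s. 2 * \<rho> s - Itil \<rho> chi a s)) * chi \<tau>) \<le> 0"
    and z: "\<And>t. t \<in> {a..b} \<Longrightarrow> (z has_vector_derivative z' t) (at t within {a..b})"
    and ineq: "\<And>t. t \<in> {a..b} \<Longrightarrow> z' t \<ge> - (z t)\<^sup>2 - 2 * \<rho> t * z t - chi t"
    and za: "z a > 0"
  shows "z b > 0"
proof (cases "a = b")
  case False
  then have ab': "a < b" using ab by simp
  have c2: "continuous_on {a..b} (\<lambda>s. 2 * \<rho> s)" by (intro continuous_intros \<rho>)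
  define I where "I = Itil \<rho> chi a"
  \<comment> \<open>\<open>J\<close> is the split form of \<open>I\<close>; the function called
    \<zeta>_0 above is \<open>- J\<close>.\<close>
  define J where "J t = exp (integral {a..t} (\<lambda>s. - (2 * \<rho> s))) *
    integral {a..t} (\<lambda>\<tau>. exp (integral {a..\<tau>} (\<lambda>s. 2 * \<rho> s)) * chi \<tau>)" for t
  have IJ: "I t = J t" if "t \<in> {a..b}" for t
    unfolding I_def J_def Itil_eq[OF \<rho> that] by simp
  have cm2: "continuous_on {a..b} (\<lambda>s. - (2 * \<rho> s))" by (intro continuous_intros \<rho>)
  have ce: "continuous_on {a..b} (\<lambda>\<tau>. exp (integral {a..\<tau>} (\<lambda>s. 2 * \<rho> s)) * chi \<tau>)"
    by (intro continuous_intros chi continuous_on_integral_Icc c2)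
  have J': "(J has_vector_derivative (chi t - 2 * \<rho> t * J t)) (at t within {a..b})" if t: "t \<in> {a..b}" for t
  proof -
    have "(J has_vector_derivative exp (integral {a..t} (\<lambda>s. - (2 * \<rho> s))) *
        (exp (integral {a..t} (\<lambda>s. 2 * \<rho> s)) * chi t) + (- (2 * \<rho> t)) * exp (integral {a..t} (\<lambda>s. - (2 * \<rho> s))) *
        integral {a..t} (\<lambda>\<tau>. exp (integral {a..\<tau>} (\<lambda>s. 2 * \<rho> s)) * chi \<tau>)) (at t within {a..b})"
      unfolding J_def[abs_def]
      by (rule has_vector_derivative_mult[OF exp_integral_has_vector_derivative[OF cm2 t]
            integral_has_vector_derivative[OF ce t]])
    then show ?thesis
      by (rule has_vector_derivative_eq_rhs) (simp add: J_def exp_minus field_simps)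
  qed
  have cJ: "continuous_on {a..b} J"
    by (rule has_vector_derivative_imp_continuous_on[OF J'])
  have cI: "continuous_on {a..b} I"
    using cJ by (subst continuous_on_cong[OF refl IJ]) auto
  have cH: "continuous_on {a..b} (\<lambda>s. 2 * \<rho> s - I s)" by (intro continuous_intros \<rho> cI)
  have cHm: "continuous_on {a..b} (\<lambda>s. - (2 * \<rho> s - I s))" by (intro continuous_intros \<rho> cI)
  define H where "H t = integral {a..t} (\<lambda>s. 2 * \<rho> s - I s)" for t
  have cF: "continuous_on {a..b} (\<lambda>\<tau>. exp (H \<tau>) * chi \<tau>)"
    unfolding H_def by (intro continuous_intros chi continuous_on_integral_Icc cH)
  define Kf where "Kf t = integral {a..t} (\<lambda>\<tau>. exp (H \<tau>) * chi \<tau>)" for t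
  have cK: "continuous_on {a..b} Kf" unfolding Kf_def by (rule continuous_on_integral_Icc[OF cF])
  \<comment> \<open>The sign condition is available only for \<open>t < b\<close>; continuity
    carries it to the right end.\<close>
  have Kneg: "Kf t \<le> 0" if "t \<in> {a..b}" for t
  proof -
    have "closure {a..<b} = {a..b}" using ab' by simp
    moreover have "Kf s \<le> 0" if "s \<in> {a..<b}" for s
      using K[of s] that by (simp add: Kf_def H_def I_def)
    ultimately show ?thesis
      using continuous_le_on_closure[of "{a..<b}" Kf t 0] cK that by simp
  qed
  define \<zeta> where "\<zeta> t = - (exp (integral {a..t} (\<lambda>s. - (2 * \<rho> s - I s))) * Kf t)" for t
  have \<zeta>nn: "\<zeta> t \<ge> 0" if "t \<in> {a..b}" for t
    using Kneg[OF that] unfolding \<zeta>_def by (simp add: mult_nonneg_nonpos)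
  have \<zeta>': "(\<zeta> has_vector_derivative (- (2 * \<rho> t - I t) * \<zeta> t - chi t)) (at t within {a..b})"
    if t: "t \<in> {a..b}" for t
  proof -
    have "(\<zeta> has_vector_derivative - (exp (integral {a..t} (\<lambda>s. - (2 * \<rho> s - I s))) *
        (exp (H t) * chi t) + (- (2 * \<rho> t - I t)) * exp (integral {a..t} (\<lambda>s. - (2 * \<rho> s - I s))) *
        Kf t)) (at t within {a..b})"
      unfolding \<zeta>_def[abs_def]
      by (rule has_vector_derivative_minus[OF has_vector_derivative_mult[OF
            exp_integral_has_vector_derivative[OF cHm t]
            integral_has_vector_derivative[OF cF t, folded Kf_def]]])
    moreover have "exp (integral {a..t} (\<lambda>s. - (2 * \<rho> s - I s))) * (exp (H t) * chi t) = chi t"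
    proof -
      have "integral {a..t} (\<lambda>s. - (2 * \<rho> s - I s)) = - H t" unfolding H_def by (rule Henstock_Kurzweil_Integration.integral_neg)
      then show ?thesis by (simp add: exp_minus)
    qed
    ultimately show ?thesis
      by (elim has_vector_derivative_eq_rhs) (simp add: \<zeta>_def algebra_simps)
  qed
  have c\<zeta>: "continuous_on {a..b} \<zeta>"
    by (rule has_vector_derivative_imp_continuous_on[OF \<zeta>'])
  \<comment> \<open>The difference vanishes at \<open>a\<close> and satisfies a linear inequality
    with coefficient \<open>2 * \<rho> - \<zeta>\<close>, in which the excess is exactly the square
    of \<open>\<zeta>\<close>.\<close>
  have D: "- J t - \<zeta> t \<ge> 0" if t: "t \<in> {a..b}" for t
  proof -
    have sub: "{a..t} \<subseteq> {a..b}" using t by auto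
    have "- J a - \<zeta> a \<le> exp (integral {a..t} (\<lambda>s. 2 * \<rho> s - \<zeta> s)) * (- J t - \<zeta> t)"
    proof (rule linear_differential_inequality)
      show "a \<le> t" using t by simp
      show "continuous_on {a..t} (\<lambda>s. 2 * \<rho> s - \<zeta> s)"
        by (rule continuous_on_subset[OF _ sub]) (intro continuous_intros \<rho> c\<zeta>)
      fix s assume "s \<in> {a..t}"
      then have s: "s \<in> {a..b}" using sub by auto
      show "((\<lambda>t. - J t - \<zeta> t) has_vector_derivative
          - (chi s - 2 * \<rho> s * J s) - (- (2 * \<rho> s - I s) * \<zeta> s - chi s)) (at s within {a..t})"
        by (rule has_vector_derivative_within_subset[OF has_vector_derivative_diff[OF
              has_vector_derivative_minus[OF J'[OF s]] \<zeta>'[OF s]] sub])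
      have "0 \<le> (\<zeta> s)\<^sup>2" by simp
      then show "- (2 * \<rho> s - \<zeta> s) * (- J s - \<zeta> s)
          \<le> - (chi s - 2 * \<rho> s * J s) - (- (2 * \<rho> s - I s) * \<zeta> s - chi s)"
        unfolding IJ[OF s] by (simp add: algebra_simps power2_eq_square)
    qed
    moreover have "J a = 0" "\<zeta> a = 0" by (simp_all add: J_def \<zeta>_def Kf_def)
    ultimately have "0 \<le> exp (integral {a..t} (\<lambda>s. 2 * \<rho> s - \<zeta> s)) * (- J t - \<zeta> t)" by simp
    then show ?thesis by (simp only: zero_le_mult_iff exp_gt_zero not_exp_le_zero) auto
  qed
  \<comment> \<open>Comparison of \<open>z\<close> with the subsolution: the difference of the two
    quadratic terms factors as \<open>(z + \<zeta>) * (z - \<zeta>)\<close>, and what remains is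
    \<open>\<zeta> * (- J - \<zeta>)\<close>, a product of nonnegative factors.\<close>
  have "z a - \<zeta> a \<le> exp (integral {a..b} (\<lambda>s. z s + \<zeta> s + 2 * \<rho> s)) * (z b - \<zeta> b)"
  proof (rule linear_differential_inequality[OF ab])
    show "continuous_on {a..b} (\<lambda>s. z s + \<zeta> s + 2 * \<rho> s)"
      by (intro continuous_intros \<rho> c\<zeta> has_vector_derivative_imp_continuous_on[OF z])
    fix s assume s: "s \<in> {a..b}"
    show "((\<lambda>t. z t - \<zeta> t) has_vector_derivative
        z' s - (- (2 * \<rho> s - I s) * \<zeta> s - chi s)) (at s within {a..b})"
      by (rule has_vector_derivative_diff[OF z[OF s] \<zeta>'[OF s]])
    have "0 \<le> \<zeta> s * (- J s - \<zeta> s)" using D[OF s] \<zeta>nn[OF s] by simp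
    then show "- (z s + \<zeta> s + 2 * \<rho> s) * (z s - \<zeta> s) \<le> z' s - (- (2 * \<rho> s - I s) * \<zeta> s - chi s)"
      using ineq[OF s] unfolding IJ[OF s] by (simp add: algebra_simps power2_eq_square)
  qed
  moreover have "\<zeta> a = 0" by (simp add: \<zeta>_def Kf_def)
  ultimately have "0 < exp (integral {a..b} (\<lambda>s. z s + \<zeta> s + 2 * \<rho> s)) * (z b - \<zeta> b)" using za by simp
  then have "0 < z b - \<zeta> b" by (simp only: zero_less_mult_iff exp_gt_zero not_exp_less_zero) auto
  then show ?thesis using \<zeta>nn[of b] ab by simp
qed (use za in simp)

section \<open>Running suprema and a bound for linear scalar equations\<close>

lemma bdd_above_continuous_Icc:
  fixes f :: "real \<Rightarrow> real"
  assumes "continuous_on {a..} f"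
  shows "bdd_above (f ` {a..t})"
proof -
  have "compact (f ` {a..t})"
    by (rule compact_continuous_image) (auto intro: continuous_on_subset[OF assms])
  then show ?thesis by (intro bounded_imp_bdd_above compact_imp_bounded)
qed

text \<open>Enlarging the interval from \<open>s\<close> to \<open>t\<close> raises the supremum by
  at most the amount by which \<open>f\<close> exceeds \<open>f s\<close> on the added
  piece.\<close>

lemma continuous_on_running_SUP:
  fixes f :: "real \<Rightarrow> real"
  assumes f: "continuous_on {a..} f"
  shows "continuous_on {a..} (\<lambda>t. SUP \<tau>\<in>{a..t}. f \<tau>)"
proof -
  let ?M = "\<lambda>t. SUP \<tau>\<in>{a..t}. f \<tau>"
  have bdd: "bdd_above (f ` {a..t})" for t
    by (rule bdd_above_continuous_Icc[OF f])
  have key: "\<bar>?M s - ?M t\<bar> \<le> e"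
    if st: "a \<le> s" "s \<le> t" and e: "\<And>\<tau>. \<tau> \<in> {s..t} \<Longrightarrow> f \<tau> \<le> f s + e" for s t e
  proof -
    have "0 \<le> e" using e[of s] st by simp
    have "?M s \<le> ?M t" by (rule cSUP_subset_mono[OF _ bdd]) (use st in auto)
    moreover have "?M t \<le> ?M s + e"
    proof (rule cSUP_least)
      show "{a..t} \<noteq> {}" using st by simp
      fix \<tau> assume \<tau>: "\<tau> \<in> {a..t}"
      have fs: "f x \<le> ?M s" if "x \<in> {a..s}" for x by (rule cSUP_upper[OF that bdd])
      show "f \<tau> \<le> ?M s + e"
      proof (cases "\<tau> \<le> s")
        case True then show ?thesis using fs[of \<tau>] \<tau> \<open>0 \<le> e\<close> by simp
      next
        case False then show ?thesis using e[of \<tau>] fs[of s] \<tau> st by simp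
      qed
    qed
    ultimately show ?thesis by simp
  qed
  show ?thesis
    unfolding continuous_on_iff
  proof (intro ballI allI impI)
    fix t e :: real assume t: "t \<in> {a..}" and e: "0 < e"
    then obtain d where d: "d > 0" "\<And>s. s \<in> {a..} \<Longrightarrow> dist s t < d \<Longrightarrow> dist (f s) (f t) < e / 3"
      using f[unfolded continuous_on_iff, rule_format, OF t, of "e / 3"] by auto
    have "dist (?M s) (?M t) < e" if s: "s \<in> {a..}" "dist s t < d" for s
    proof -
      have fd: "\<bar>f x - f t\<bar> < e / 3" if "x \<in> {a..}" "\<bar>x - t\<bar> < d" for x
        using d(2)[of x] that by (simp add: dist_real_def)
      show ?thesis
      proof (cases "s \<le> t")
        case True
        \<comment> \<open>Here \<open>f \<tau>\<close> and \<open>f s\<close> are compared through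
          \<open>f t\<close>, at a cost of \<open>e / 3\<close> each.\<close>
        have "\<bar>?M s - ?M t\<bar> \<le> 2 * e / 3"
        proof (rule key)
          fix \<tau> assume "\<tau> \<in> {s..t}"
          then have "\<bar>f \<tau> - f t\<bar> < e / 3" "\<bar>f s - f t\<bar> < e / 3"
            using fd[of \<tau>] fd[of s] s by (auto simp: dist_real_def)
          then show "f \<tau> \<le> f s + 2 * e / 3" by argo
        qed (use s True in auto)
        then show ?thesis using e by (simp add: dist_real_def)
      next
        case False
        have "\<bar>?M t - ?M s\<bar> \<le> 2 * e / 3"
        proof (rule key)
          fix \<tau> assume "\<tau> \<in> {t..s}"
          then have "\<bar>f \<tau> - f t\<bar> < e / 3"
            using fd[of \<tau>] s t by (auto simp: dist_real_def)
          then show "f \<tau> \<le> f t + 2 * e / 3" using e by argo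
        qed (use t False in auto)
        then show ?thesis using e unfolding dist_real_def by argo
      qed
    qed
    with d(1) show "\<exists>d>0. \<forall>s\<in>{a..}. dist s t < d \<longrightarrow> dist (?M s) (?M t) < e" by blast
  qed
qed

text \<open>The damping \<open>\<alpha>\<close> also dominates the forcing \<open>h\<close>, as
  \<open>\<beta> \<le> \<alpha>\<close>. After multiplication by the integrating factor, the
  integral of \<open>\<alpha>\<close> times its exponential reproduces that exponential, which then
  cancels. So the bound is free of \<open>\<alpha>\<close> and \<open>\<beta>\<close>, later built
  from the unknown diagonal of the Riccati solution.\<close>

lemma norm_linear_ode_bound:
  fixes u h g \<kappa> w :: "real \<Rightarrow> complex" and \<alpha> \<beta> :: "real \<Rightarrow> real"
  assumes T: "t0 \<le> T" and \<alpha>: "continuous_on {t0..T} \<alpha>" and \<kappa>: "continuous_on {t0..T} \<kappa>"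
    and g: "continuous_on {t0..T} g"
    and u: "\<And>t. t \<in> {t0..T} \<Longrightarrow>
      (u has_vector_derivative (- (of_real (\<alpha> t) + \<kappa> t) * u t + h t + g t)) (at t within {t0..T})"
    and \<beta>: "\<And>t. t \<in> {t0..T} \<Longrightarrow> 0 \<le> \<beta> t \<and> \<beta> t \<le> \<alpha> t"
    and h: "\<And>t. t \<in> {t0..T} \<Longrightarrow> cmod (h t) \<le> \<beta> t * cmod (w t)"
    and u0: "cmod (u t0) \<le> cmod (w t0)"
    and m: "\<And>t. t \<in> {t0..T} \<Longrightarrow> exp (Re (integral {t0..t} \<kappa>)) * cmod (w t) \<le> m"
  shows "cmod (u T) \<le> exp (- Re (integral {t0..T} \<kappa>)) *
    (m + integral {t0..T} (\<lambda>t. exp (Re (integral {t0..t} \<kappa>)) * cmod (g t)))"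
proof -
  define R where "R t = Re (integral {t0..t} \<kappa>)" for t
  define E where "E t = exp (integral {t0..t} \<alpha>)" for t
  define \<Gamma> where "\<Gamma> t = integral {t0..t} (\<lambda>t. exp (R t) * cmod (g t))" for t
  define f where "f t = exp (integral {t0..t} (\<lambda>s. of_real (\<alpha> s) + \<kappa> s)) * u t" for t
  have c1: "continuous_on {t0..T} (\<lambda>s. complex_of_real (\<alpha> s) + \<kappa> s)" by (intro continuous_intros \<alpha> \<kappa>)
  have cR: "continuous_on {t0..T} (\<lambda>t. exp (R t) * cmod (g t))"
    unfolding R_def by (intro continuous_intros continuous_on_integral_Icc \<kappa> g)
  have \<Gamma>nn: "0 \<le> \<Gamma> t" if "t \<in> {t0..T}" for t
    unfolding \<Gamma>_def
    by (rule Henstock_Kurzweil_Integration.integral_nonneg[OF integrable_continuous_real])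
      (use that in \<open>auto intro: continuous_on_subset[OF cR]\<close>)
  have m0: "0 \<le> m"
    using m[of t0] T by (smt (verit) atLeastAtMost_iff exp_ge_zero mult_nonneg_nonneg norm_ge_zero)
  have cmod_f: "cmod (exp (integral {t0..t} (\<lambda>s. of_real (\<alpha> s) + \<kappa> s))) = E t * exp (R t)"
    if t: "t \<in> {t0..T}" for t
  proof -
    have i: "\<alpha> integrable_on {t0..t}" "\<kappa> integrable_on {t0..t}"
      using t by (auto intro!: integrable_continuous_real continuous_on_subset[OF \<alpha>] continuous_on_subset[OF \<kappa>])
    have ia: "((\<lambda>s. complex_of_real (\<alpha> s)) has_integral of_real (integral {t0..t} \<alpha>)) {t0..t}"
      by (rule has_integral_of_real[OF integrable_integral[OF i(1)]])
    have "integral {t0..t} (\<lambda>s. complex_of_real (\<alpha> s) + \<kappa> s) = of_real (integral {t0..t} \<alpha>) + integral {t0..t} \<kappa>"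
      by (rule integral_unique[OF has_integral_add[OF ia integrable_integral[OF i(2)]]])
    then show ?thesis by (simp add: E_def R_def exp_add norm_mult)
  qed
  \<comment> \<open>The majorant \<open>E * (m + \<Gamma>)\<close> is chosen so that its derivative
    consists of an \<open>\<alpha>\<close> term absorbing \<open>h\<close> and a term absorbing
    \<open>g\<close>.\<close>
  have "norm (f T - f t0) \<le> E T * (m + \<Gamma> T) - E t0 * (m + \<Gamma> t0)"
  proof (rule vector_derivative_norm_bound[OF T])
    fix t assume t: "t \<in> {t0..T}"
    let ?e = "exp (integral {t0..t} (\<lambda>s. of_real (\<alpha> s) + \<kappa> s))"
    have "(f has_vector_derivative (?e * (- (of_real (\<alpha> t) + \<kappa> t) * u t + h t + g t) +
        (of_real (\<alpha> t) + \<kappa> t) * ?e * u t)) (at t within {t0..T})"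
      unfolding f_def
      by (rule has_vector_derivative_mult[OF exp_integral_has_vector_derivative[OF c1 t] u[OF t]])
    then show "(f has_vector_derivative ?e * (h t + g t)) (at t within {t0..T})"
      by (rule has_vector_derivative_eq_rhs) (simp add: algebra_simps)
    show "((\<lambda>t. E t * (m + \<Gamma> t)) has_vector_derivative
        (E t * (0 + exp (R t) * cmod (g t)) + \<alpha> t * E t * (m + \<Gamma> t))) (at t within {t0..T})"
      unfolding E_def \<Gamma>_def
      by (rule has_vector_derivative_mult[OF exp_integral_has_vector_derivative[OF \<alpha> t]
            has_vector_derivative_add[OF has_vector_derivative_const integral_has_vector_derivative[OF cR t]]])
    have "norm (?e * (h t + g t)) \<le> E t * exp (R t) * (\<beta> t * cmod (w t) + cmod (g t))"
      unfolding norm_mult cmod_f[OF t]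
      by (rule mult_left_mono) (use norm_triangle_ineq[of "h t" "g t"] h[OF t] in \<open>auto simp: E_def\<close>)
    also have "\<dots> = E t * (\<beta> t * (exp (R t) * cmod (w t)) + exp (R t) * cmod (g t))"
      by (simp add: algebra_simps)
    also have "\<dots> \<le> E t * (\<alpha> t * (m + \<Gamma> t) + exp (R t) * cmod (g t))"
    proof (rule mult_left_mono)
      have "\<beta> t * (exp (R t) * cmod (w t)) \<le> \<alpha> t * m"
        using \<beta>[OF t] m[OF t] by (intro mult_mono) (auto simp: R_def)
      moreover have "\<alpha> t * m \<le> \<alpha> t * (m + \<Gamma> t)" using \<beta>[OF t] \<Gamma>nn[OF t] by (intro mult_left_mono) auto
      ultimately show "\<beta> t * (exp (R t) * cmod (w t)) + exp (R t) * cmod (g t)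
          \<le> \<alpha> t * (m + \<Gamma> t) + exp (R t) * cmod (g t)" by simp
    qed (simp add: E_def)
    finally show "norm (?e * (h t + g t)) \<le> E t * (0 + exp (R t) * cmod (g t)) + \<alpha> t * E t * (m + \<Gamma> t)"
      by (simp add: algebra_simps)
  qed
  moreover have "f t0 = u t0" "E t0 = 1" "\<Gamma> t0 = 0" by (simp_all add: f_def E_def \<Gamma>_def)
  moreover have "cmod (u t0) \<le> m" using m[of t0] u0 T by simp
  moreover have "norm (f T) \<le> norm (f T - f t0) + norm (f t0)"
    using norm_triangle_ineq[of "f T - f t0" "f t0"] by simp
  ultimately have "norm (f T) \<le> E T * (m + \<Gamma> T)" by simp
  moreover have "norm (f T) = E T * (exp (R T) * cmod (u T))"
    unfolding f_def norm_mult using cmod_f[of T] T by simp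
  ultimately have "E T * (exp (R T) * cmod (u T)) \<le> E T * (m + \<Gamma> T)" by simp
  then have "exp (R T) * cmod (u T) \<le> m + \<Gamma> T"
    using mult_le_cancel_left_pos[of "E T"] by (simp add: E_def)
  then have "cmod (u T) \<le> exp (- R T) * (m + \<Gamma> T)"
    by (simp add: exp_minus field_simps)
  then show ?thesis by (simp add: R_def \<Gamma>_def)
qed

text \<open>Induction along the nodes: positivity at one node is the initial condition on the next
  interval, and the nodes eventually pass \<open>T\<close>.\<close>

lemma cond4_supersolution_positive:
  fixes \<rho> chi z :: "real \<Rightarrow> real"
  assumes c4: "cond4 \<rho> chi t0" and \<rho>: "continuous_on {t0..} \<rho>" and chi: "continuous_on {t0..} chi"
    and T: "t0 \<le> T"
    and z: "\<And>t. t \<in> {t0..T} \<Longrightarrow> (z has_vector_derivative z' t) (at t within {t0..T})"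
    and ineq: "\<And>t. t \<in> {t0..T} \<Longrightarrow> z' t \<ge> - (z t)\<^sup>2 - 2 * \<rho> t * z t - chi t"
    and z0: "z t0 > 0"
  shows "z T > 0"
proof -
  obtain \<xi> :: "nat \<Rightarrow> real" where \<xi>: "\<xi> 0 = t0" "strict_mono \<xi>" "filterlim \<xi> at_top sequentially"
    and neg: "\<And>m t. \<xi> m \<le> t \<Longrightarrow> t < \<xi> (Suc m) \<Longrightarrow>
        integral {\<xi> m..t} (\<lambda>\<tau>. exp (integral {\<xi> m..\<tau>} (\<lambda>s. 2 * \<rho> s - Itil \<rho> chi (\<xi> m) s)) * chi \<tau>) \<le> 0"
    using c4 unfolding cond4_def by blast
  have \<xi>0: "t0 \<le> \<xi> m" for m
    using strict_mono_less_eq[OF \<xi>(2), of 0 m] \<xi>(1) by simp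
  have "\<forall>t\<in>{t0..T}. t \<le> \<xi> k \<longrightarrow> 0 < z t" for k
  proof (induction k)
    case 0
    show ?case using z0 \<xi>(1) by auto
  next
    case (Suc k)
    show ?case
    proof (intro ballI impI)
      fix t assume t: "t \<in> {t0..T}" "t \<le> \<xi> (Suc k)"
      show "0 < z t"
      proof (cases "t \<le> \<xi> k")
        case True then show ?thesis using Suc t by blast
      next
        case False
        then have sub: "{\<xi> k..t} \<subseteq> {t0..T}" using \<xi>0[of k] t by auto
        show ?thesis
        proof (rule riccati_supersolution_positive[of "\<xi> k" t \<rho> chi z z'])
          show "\<xi> k \<le> t" using False by simp
          show "continuous_on {\<xi> k..t} \<rho>" "continuous_on {\<xi> k..t} chi"
            by (rule continuous_on_subset[OF \<rho>], use sub in force)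
               (rule continuous_on_subset[OF chi], use sub in force)
          show "0 < z (\<xi> k)" using Suc False \<xi>0[of k] t by auto
        qed (use neg[of k] t sub in \<open>auto intro!: ineq has_vector_derivative_within_subset[OF z]\<close>)
      qed
    qed
  qed
  moreover obtain k where "T \<le> \<xi> k"
    using \<xi>(3) unfolding filterlim_at_top eventually_sequentially by blast
  ultimately show ?thesis using T by auto
qed

section \<open>The matrix Riccati equation\<close>

definition offdiag_rate :: "(real \<Rightarrow> complex^2^2) \<Rightarrow> real \<Rightarrow> complex" where
  "offdiag_rate P s = cnj (P s $ 1 $ 1) + P s $ 2 $ 2"

text \<open>The common form of the squared brackets in \<open>chi3\<close> and \<open>chi4\<close>:
  both take the same \<open>w\<close>, whose supremum is \<open>Mtil\<close>, and differ in
  \<open>g\<close>.\<close>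

definition offdiag_bound ::
  "(real \<Rightarrow> complex^2^2) \<Rightarrow> real \<Rightarrow> (real \<Rightarrow> complex) \<Rightarrow> (real \<Rightarrow> complex) \<Rightarrow> real \<Rightarrow> real" where
  "offdiag_bound P t0 w g t = (SUP \<tau>\<in>{t0..t}. cmod (Ekern P \<tau> t * w \<tau>))
     + integral {t0..t} (\<lambda>\<tau>. cmod (Ekern P \<tau> t * g \<tau>))"

lemma continuous_on_entry [continuous_intros]:
  assumes "continuous_on A (M :: _ \<Rightarrow> complex^'n^'m)"
  shows "continuous_on A (\<lambda>t. M t $ i $ j)"
  by (intro continuous_on_component assms)

lemma continuous_on_offdiag_rate:
  assumes "continuous_on A P"
  shows "continuous_on A (offdiag_rate P)"
  unfolding offdiag_rate_def[abs_def] by (intro continuous_intros assms)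

lemma cmod_Ekern:
  assumes P: "continuous_on {t0..} P" and "t0 \<le> \<tau>" "\<tau> \<le> t"
  shows "cmod (Ekern P \<tau> t) = exp (- Re (integral {t0..t} (offdiag_rate P))) * exp (Re (integral {t0..\<tau>} (offdiag_rate P)))"
proof -
  have "continuous_on {t0..t} (offdiag_rate P)"
    by (rule continuous_on_subset[OF continuous_on_offdiag_rate[OF P]]) auto
  from integral_Icc_diff[OF this assms(2,3)]
  have "Re (integral {\<tau>..t} (offdiag_rate P)) = Re (integral {t0..t} (offdiag_rate P)) - Re (integral {t0..\<tau>} (offdiag_rate P))" by simp
  then show ?thesis by (simp add: Ekern_def offdiag_rate_def[abs_def] exp_add[symmetric])
qed

lemma cSUP_mult_left_pos:
  fixes f :: "'a \<Rightarrow> real"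
  assumes c: "c > 0" and A: "A \<noteq> {}" and bdd: "bdd_above (f ` A)"
  shows "(SUP x\<in>A. c * f x) = c * (SUP x\<in>A. f x)"
proof (rule antisym)
  have bdd': "bdd_above ((\<lambda>x. c * f x) ` A)"
    using bdd c by (auto simp: bdd_above_def) (meson mult_le_cancel_left_pos)
  show "(SUP x\<in>A. c * f x) \<le> c * (SUP x\<in>A. f x)"
    using c by (intro cSUP_least[OF A] mult_left_mono cSUP_upper[OF _ bdd]) auto
  have "(SUP x\<in>A. f x) \<le> (SUP x\<in>A. c * f x) / c"
  proof (rule cSUP_least[OF A])
    fix x assume "x \<in> A"
    then have "c * f x \<le> (SUP x\<in>A. c * f x)" by (rule cSUP_upper[OF _ bdd'])
    then show "f x \<le> (SUP x\<in>A. c * f x) / c" using c by (simp add: field_simps)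
  qed
  then show "c * (SUP x\<in>A. f x) \<le> (SUP x\<in>A. c * f x)" using c by (simp add: field_simps)
qed

text \<open>The modulus of the kernel splits into a factor in \<open>t\<close> and a factor in
  \<open>\<tau>\<close>. With the former pulled out, a running supremum and a running integral of
  fixed functions remain, which yields continuity and matches the bound for linear
  equations.\<close>

lemma offdiag_bound_eq:
  assumes P: "continuous_on {t0..} P" and w: "continuous_on {t0..} w" and t: "t0 \<le> t"
  shows "offdiag_bound P t0 w g t = exp (- Re (integral {t0..t} (offdiag_rate P))) *
    ((SUP \<tau>\<in>{t0..t}. exp (Re (integral {t0..\<tau>} (offdiag_rate P))) * cmod (w \<tau>)) +
     integral {t0..t} (\<lambda>\<tau>. exp (Re (integral {t0..\<tau>} (offdiag_rate P))) * cmod (g \<tau>)))"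
proof -
  let ?c = "exp (- Re (integral {t0..t} (offdiag_rate P)))"
  let ?e = "\<lambda>\<tau>. exp (Re (integral {t0..\<tau>} (offdiag_rate P)))"
  have e: "cmod (Ekern P \<tau> t * x) = ?c * (?e \<tau> * cmod x)" if "\<tau> \<in> {t0..t}" for \<tau> x
    using cmod_Ekern[OF P, of \<tau> t] that by (simp add: norm_mult)
  have c: "continuous_on {t0..} (\<lambda>\<tau>. ?e \<tau> * cmod (w \<tau>))"
    by (intro continuous_intros continuous_on_integral_Ici continuous_on_offdiag_rate P w)
  have "(SUP \<tau>\<in>{t0..t}. cmod (Ekern P \<tau> t * w \<tau>)) = (SUP \<tau>\<in>{t0..t}. ?c * (?e \<tau> * cmod (w \<tau>)))"
    by (rule SUP_cong[OF refl]) (rule e)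
  also have "\<dots> = ?c * (SUP \<tau>\<in>{t0..t}. ?e \<tau> * cmod (w \<tau>))"
    by (rule cSUP_mult_left_pos[OF _ _ bdd_above_continuous_Icc[OF c]]) (use t in auto)
  finally have 1: "(SUP \<tau>\<in>{t0..t}. cmod (Ekern P \<tau> t * w \<tau>)) = ?c * (SUP \<tau>\<in>{t0..t}. ?e \<tau> * cmod (w \<tau>))" .
  have "integral {t0..t} (\<lambda>\<tau>. cmod (Ekern P \<tau> t * g \<tau>)) = integral {t0..t} (\<lambda>\<tau>. ?c * (?e \<tau> * cmod (g \<tau>)))"
    by (rule Henstock_Kurzweil_Integration.integral_cong) (rule e)
  then have 2: "integral {t0..t} (\<lambda>\<tau>. cmod (Ekern P \<tau> t * g \<tau>)) = ?c * integral {t0..t} (\<lambda>\<tau>. ?e \<tau> * cmod (g \<tau>))"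
    by simp
  show ?thesis unfolding offdiag_bound_def 1 2 by (simp add: distrib_left)
qed

lemma continuous_on_offdiag_bound:
  assumes P: "continuous_on {t0..} P" and w: "continuous_on {t0..} w" and g: "continuous_on {t0..} g"
  shows "continuous_on {t0..} (offdiag_bound P t0 w g)"
proof -
  have "continuous_on {t0..} (\<lambda>t. exp (- Re (integral {t0..t} (offdiag_rate P))) *
    ((SUP \<tau>\<in>{t0..t}. exp (Re (integral {t0..\<tau>} (offdiag_rate P))) * cmod (w \<tau>)) +
     integral {t0..t} (\<lambda>\<tau>. exp (Re (integral {t0..\<tau>} (offdiag_rate P))) * cmod (g \<tau>))))"
    by (intro continuous_intros continuous_on_running_SUP continuous_on_integral_Ici continuous_on_offdiag_rate P w g)
  then show ?thesis
    by (subst continuous_on_cong[OF refl offdiag_bound_eq[OF P w]]) auto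
qed

lemma offdiag_solution_bound:
  fixes u h g w :: "real \<Rightarrow> complex" and \<alpha> \<beta> :: "real \<Rightarrow> real"
  assumes P: "continuous_on {t0..} P" and w: "continuous_on {t0..} w" and g: "continuous_on {t0..} g"
    and T: "t0 \<le> T" and \<alpha>: "continuous_on {t0..T} \<alpha>"
    and u: "\<And>t. t \<in> {t0..T} \<Longrightarrow>
      (u has_vector_derivative (- (of_real (\<alpha> t) + offdiag_rate P t) * u t + h t + g t)) (at t within {t0..T})"
    and \<beta>: "\<And>t. t \<in> {t0..T} \<Longrightarrow> 0 \<le> \<beta> t \<and> \<beta> t \<le> \<alpha> t"
    and h: "\<And>t. t \<in> {t0..T} \<Longrightarrow> cmod (h t) \<le> \<beta> t * cmod (w t)"
    and u0: "cmod (u t0) \<le> cmod (w t0)"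
  shows "cmod (u T) \<le> offdiag_bound P t0 w g T"
  unfolding offdiag_bound_eq[OF P w T]
proof (rule norm_linear_ode_bound[OF T \<alpha> _ _ u \<beta> h u0])
  show "continuous_on {t0..T} (offdiag_rate P)" "continuous_on {t0..T} g"
    by (auto intro: continuous_on_subset[OF continuous_on_offdiag_rate[OF P]] continuous_on_subset[OF g])
  have c: "continuous_on {t0..} (\<lambda>\<tau>. exp (Re (integral {t0..\<tau>} (offdiag_rate P))) * cmod (w \<tau>))"
    by (intro continuous_intros continuous_on_integral_Ici continuous_on_offdiag_rate P w)
  show "exp (Re (integral {t0..t} (offdiag_rate P))) * cmod (w t)
      \<le> (SUP \<tau>\<in>{t0..T}. exp (Re (integral {t0..\<tau>} (offdiag_rate P))) * cmod (w \<tau>))" if "t \<in> {t0..T}" for t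
    by (rule cSUP_upper[OF that bdd_above_continuous_Icc[OF c]])
qed

lemma first_zero:
  fixes f :: "real \<Rightarrow> real"
  assumes f: "continuous_on {a..b} f" and "f a > 0" and "\<exists>t\<in>{a..b}. f t \<le> 0"
  obtains T where "T \<in> {a..b}" "f T = 0" "\<And>t. a \<le> t \<Longrightarrow> t < T \<Longrightarrow> f t > 0"
proof -
  define N where "N = {t \<in> {a..b}. f t \<le> 0}"
  have "closed N" unfolding N_def
    by (rule continuous_on_closed_Collect_le[OF f]) auto
  have ne: "N \<noteq> {}" and bb: "bdd_below N" using assms(3) by (auto simp: N_def intro: bdd_belowI[of _ a])
  define T where "T = Inf N"
  have TN: "T \<in> N" unfolding T_def by (rule closed_contains_Inf[OF ne bb \<open>closed N\<close>])
  have pos: "f t > 0" if "a \<le> t" "t < T" for t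
  proof (rule ccontr)
    assume "\<not> ?thesis"
    then have "t \<in> N" using that TN by (auto simp: N_def)
    then have "T \<le> t" unfolding T_def by (rule cInf_lower[OF _ bb])
    then show False using that by simp
  qed
  have "\<exists>x. a \<le> x \<and> x \<le> T \<and> f x = 0"
    by (rule IVT2') (use TN assms(2) in \<open>auto simp: N_def intro: continuous_on_subset[OF f]\<close>)
  then obtain x where "a \<le> x" "x \<le> T" "f x = 0" by blast
  then have "f T = 0" using pos[of x] by (cases "x = T") auto
  with TN pos show thesis by (intro that[of T]) (auto simp: N_def)
qed

lemma chi3_eq:
  "chi3 P Q dp21 t0 t = (offdiag_bound P t0 (\<lambda>\<tau>. P \<tau> $ 1 $ 2 - cnj (P \<tau> $ 2 $ 1))
      (\<lambda>\<tau>. cnj (dp21 \<tau>) + cnj (P \<tau> $ 2 $ 1) * offdiag_rate P \<tau> + Q \<tau> $ 1 $ 2) t)\<^sup>2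
     - (cmod (P t $ 2 $ 1))\<^sup>2 - Re (Q t $ 1 $ 1)"
  by (simp add: chi3_def offdiag_bound_def Mtil_def offdiag_rate_def)

lemma chi4_eq:
  "chi4 P Q dp12 t0 t = (offdiag_bound P t0 (\<lambda>\<tau>. P \<tau> $ 1 $ 2 - cnj (P \<tau> $ 2 $ 1))
      (\<lambda>\<tau>. dp12 \<tau> + P \<tau> $ 1 $ 2 * offdiag_rate P \<tau> + Q \<tau> $ 1 $ 2) t)\<^sup>2
     - (cmod (P t $ 1 $ 2))\<^sup>2 - Re (Q t $ 2 $ 2)"
  by (simp add: chi4_def offdiag_bound_def Mtil_def offdiag_rate_def)

definition riccati_rhs :: "complex^2^2 \<Rightarrow> complex^2^2 \<Rightarrow> complex^2^2 \<Rightarrow> complex^2^2" where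
  "riccati_rhs P Q Z = Q - Z ** Z - cadj P ** Z - Z ** P"

text \<open>Completing the square in \<open>z\<close> brings each diagonal entry into scalar Riccati
  form, with the modulus of a shifted off-diagonal entry where \<open>chi3\<close> or
  \<open>chi4\<close> has its bracket.\<close>

lemma riccati_rhs_entries:
  "Re (riccati_rhs P Q (herm2 a z b) $ 1 $ 1) =
     - a\<^sup>2 - 2 * Re (P$1$1) * a - ((cmod (z + cnj (P$2$1)))\<^sup>2 - (cmod (P$2$1))\<^sup>2 - Re (Q$1$1))"
  "Re (riccati_rhs P Q (herm2 a z b) $ 2 $ 2) =
     - b\<^sup>2 - 2 * Re (P$2$2) * b - ((cmod (z + P$1$2))\<^sup>2 - (cmod (P$1$2))\<^sup>2 - Re (Q$2$2))"
  "riccati_rhs P Q (herm2 a z b) $ 1 $ 2 =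
     - (of_real (a + b) + (cnj (P$1$1) + P$2$2)) * z - of_real a * P$1$2 - of_real b * cnj (P$2$1) + Q$1$2"
  unfolding cmod_power2
  by (simp_all add: riccati_rhs_def matrix_matrix_mult_def sum_2 cadj_def power2_eq_square algebra_simps)

text \<open>Turns nonnegativity up to \<open>T\<close> into strict positivity at \<open>T\<close>,
  which is what excludes a first zero of the diagonal. Nonnegativity makes the off-diagonal bounds
  valid; these make the diagonal entries supersolutions for \<open>chi3\<close> and
  \<open>chi4\<close>, and the sign conditions then apply.\<close>

lemma riccati_diag_positive:
  fixes P Q Z :: "real \<Rightarrow> complex^2^2" and dp12 dp21 :: "real \<Rightarrow> complex"
  assumes P: "continuous_on {t0..} P" and Q: "continuous_on {t0..} Q"
    and d12: "\<forall>t\<ge>t0. ((\<lambda>s. P s $ 1 $ 2) has_vector_derivative dp12 t) (at t within {t0..})"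
    and c12: "continuous_on {t0..} dp12"
    and d21: "\<forall>t\<ge>t0. ((\<lambda>s. P s $ 2 $ 1) has_vector_derivative dp21 t) (at t within {t0..})"
    and c21: "continuous_on {t0..} dp21"
    and c4_1: "cond4 (\<lambda>s. Re (P s $ 1 $ 1)) (chi3 P Q dp21 t0) t0"
    and c4_2: "cond4 (\<lambda>s. Re (P s $ 2 $ 2)) (chi4 P Q dp12 t0) t0"
    and T: "t0 \<le> T"
    and Z: "\<And>t. t \<in> {t0..T} \<Longrightarrow> (Z has_vector_derivative riccati_rhs (P t) (Q t) (Z t)) (at t within {t0..T})"
    and herm: "\<And>t. t \<in> {t0..T} \<Longrightarrow> cadj (Z t) = Z t"
    and Z0: "Z t0 = herm2 1 (- P t0 $ 1 $ 2) 1"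
    and nn: "\<And>t. t \<in> {t0..T} \<Longrightarrow> 0 \<le> Re (Z t $ 1 $ 1) \<and> 0 \<le> Re (Z t $ 2 $ 2)"
  shows "0 < Re (Z T $ 1 $ 1) \<and> 0 < Re (Z T $ 2 $ 2)"
proof -
  define a b z where "a t = Re (Z t $ 1 $ 1)" and "b t = Re (Z t $ 2 $ 2)" and "z t = Z t $ 1 $ 2" for t
  have Zh: "Z t = herm2 (a t) (z t) (b t)" if "t \<in> {t0..T}" for t
    using hermitian_imp_herm2[OF herm[OF that]] by (simp add: a_def b_def z_def)
  define w where "w t = P t $ 1 $ 2 - cnj (P t $ 2 $ 1)" for t
  define g3 where "g3 t = cnj (dp21 t) + cnj (P t $ 2 $ 1) * offdiag_rate P t + Q t $ 1 $ 2" for t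
  define g4 where "g4 t = dp12 t + P t $ 1 $ 2 * offdiag_rate P t + Q t $ 1 $ 2" for t
  have cw: "continuous_on {t0..} w" unfolding w_def by (intro continuous_intros P)
  have cg3: "continuous_on {t0..} g3"
    unfolding g3_def by (intro continuous_intros continuous_on_offdiag_rate P Q c21)
  have cg4: "continuous_on {t0..} g4"
    unfolding g4_def by (intro continuous_intros continuous_on_offdiag_rate P Q c12)
  have chi3: "chi3 P Q dp21 t0 t = (offdiag_bound P t0 w g3 t)\<^sup>2 - (cmod (P t $ 2 $ 1))\<^sup>2 - Re (Q t $ 1 $ 1)" for t
    unfolding chi3_eq w_def[abs_def] g3_def[abs_def] ..
  have chi4: "chi4 P Q dp12 t0 t = (offdiag_bound P t0 w g4 t)\<^sup>2 - (cmod (P t $ 1 $ 2))\<^sup>2 - Re (Q t $ 2 $ 2)" for t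
    unfolding chi4_eq w_def[abs_def] g4_def[abs_def] ..
  have cZ: "continuous_on {t0..T} Z" by (rule has_vector_derivative_imp_continuous_on[OF Z])
  have ca: "continuous_on {t0..T} a" and cb: "continuous_on {t0..T} b"
    unfolding a_def b_def by (intro continuous_intros cZ)+
  have z': "(z has_vector_derivative (- (of_real (a t + b t) + offdiag_rate P t) * z t
      - of_real (a t) * P t $ 1 $ 2 - of_real (b t) * cnj (P t $ 2 $ 1) + Q t $ 1 $ 2)) (at t within {t0..T})"
    if t: "t \<in> {t0..T}" for t
    using has_vector_derivative_matrix_entry[OF Z[OF t], of 1 2]
    unfolding z_def[symmetric] Zh[OF t] riccati_rhs_entries offdiag_rate_def .
  have a': "(a has_vector_derivative (- (a t)\<^sup>2 - 2 * Re (P t $ 1 $ 1) * a t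
      - ((cmod (z t + cnj (P t $ 2 $ 1)))\<^sup>2 - (cmod (P t $ 2 $ 1))\<^sup>2 - Re (Q t $ 1 $ 1)))) (at t within {t0..T})"
    if t: "t \<in> {t0..T}" for t
    using bounded_linear.has_vector_derivative[OF bounded_linear_Re has_vector_derivative_matrix_entry[OF Z[OF t], of 1 1]]
    unfolding a_def[symmetric] Zh[OF t] riccati_rhs_entries .
  have b': "(b has_vector_derivative (- (b t)\<^sup>2 - 2 * Re (P t $ 2 $ 2) * b t
      - ((cmod (z t + P t $ 1 $ 2))\<^sup>2 - (cmod (P t $ 1 $ 2))\<^sup>2 - Re (Q t $ 2 $ 2)))) (at t within {t0..T})"
    if t: "t \<in> {t0..T}" for t
    using bounded_linear.has_vector_derivative[OF bounded_linear_Re has_vector_derivative_matrix_entry[OF Z[OF t], of 2 2]]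
    unfolding b_def[symmetric] Zh[OF t] riccati_rhs_entries .
  \<comment> \<open>The shift cancels the terms with factor \<open>b\<close>, leaving the forcing
    \<open>- a * w\<close>; the estimate needs \<open>0 \<le> a \<le> a + b\<close>. For
    \<open>v_bd\<close> the roles of \<open>a\<close> and \<open>b\<close> are exchanged.\<close>
  have u_bd: "cmod (z t + cnj (P t $ 2 $ 1)) \<le> offdiag_bound P t0 w g3 t" if t: "t \<in> {t0..T}" for t
  proof (rule offdiag_solution_bound[OF P cw cg3, where \<alpha> = "\<lambda>t. a t + b t" and \<beta> = a
        and h = "\<lambda>t. - of_real (a t) * w t" and u = "\<lambda>t. z t + cnj (P t $ 2 $ 1)"])
    have sub: "{t0..t} \<subseteq> {t0..T}" using t by auto
    show "t0 \<le> t" using t by simp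
    show "continuous_on {t0..t} (\<lambda>t. a t + b t)"
      by (rule continuous_on_subset[OF _ sub]) (intro continuous_intros ca cb)
    fix s assume "s \<in> {t0..t}"
    then have s: "s \<in> {t0..T}" and s0: "t0 \<le> s" using sub by auto
    have p': "((\<lambda>t. cnj (P t $ 2 $ 1)) has_vector_derivative cnj (dp21 s)) (at s within {t0..t})"
      by (rule bounded_linear.has_vector_derivative[OF bounded_linear_cnj
            has_vector_derivative_within_subset[OF d21[rule_format, OF s0]]]) auto
    show "((\<lambda>t. z t + cnj (P t $ 2 $ 1)) has_vector_derivative
        - (complex_of_real (a s + b s) + offdiag_rate P s) * (z s + cnj (P s $ 2 $ 1)) + - complex_of_real (a s) * w s + g3 s)
        (at s within {t0..t})"
      by (rule has_vector_derivative_eq_rhs[OF has_vector_derivative_add[OF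
          has_vector_derivative_within_subset[OF z'[OF s] sub] p']])
        (simp add: w_def g3_def algebra_simps)
    show "0 \<le> a s \<and> a s \<le> a s + b s" using nn[OF s] by (simp add: a_def b_def)
    show "cmod (- complex_of_real (a s) * w s) \<le> a s * cmod (w s)"
      using nn[OF s] by (simp add: norm_mult a_def)
  next
    \<comment> \<open>The initial value \<open>- P t0 $ 1 $ 2\<close> gives equality here and makes
      the other shifted entry vanish at \<open>t0\<close>.\<close>
    show "cmod (z t0 + cnj (P t0 $ 2 $ 1)) \<le> cmod (w t0)"
      using Z0 norm_minus_commute[of "cnj (P t0 $ 2 $ 1)" "P t0 $ 1 $ 2"] by (simp add: z_def w_def)
  qed
  have v_bd: "cmod (z t + P t $ 1 $ 2) \<le> offdiag_bound P t0 w g4 t" if t: "t \<in> {t0..T}" for t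
  proof (rule offdiag_solution_bound[OF P cw cg4, where \<alpha> = "\<lambda>t. a t + b t" and \<beta> = b
        and h = "\<lambda>t. of_real (b t) * w t" and u = "\<lambda>t. z t + P t $ 1 $ 2"])
    have sub: "{t0..t} \<subseteq> {t0..T}" using t by auto
    show "t0 \<le> t" using t by simp
    show "continuous_on {t0..t} (\<lambda>t. a t + b t)"
      by (rule continuous_on_subset[OF _ sub]) (intro continuous_intros ca cb)
    fix s assume "s \<in> {t0..t}"
    then have s: "s \<in> {t0..T}" and s0: "t0 \<le> s" using sub by auto
    have p': "((\<lambda>t. P t $ 1 $ 2) has_vector_derivative dp12 s) (at s within {t0..t})"
      by (rule has_vector_derivative_within_subset[OF d12[rule_format, OF s0]]) auto
    show "((\<lambda>t. z t + P t $ 1 $ 2) has_vector_derivative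
        - (complex_of_real (a s + b s) + offdiag_rate P s) * (z s + P s $ 1 $ 2) + complex_of_real (b s) * w s + g4 s)
        (at s within {t0..t})"
      by (rule has_vector_derivative_eq_rhs[OF has_vector_derivative_add[OF
          has_vector_derivative_within_subset[OF z'[OF s] sub] p']])
        (simp add: w_def g4_def algebra_simps)
    show "0 \<le> b s \<and> b s \<le> a s + b s" using nn[OF s] by (simp add: a_def b_def)
    show "cmod (complex_of_real (b s) * w s) \<le> b s * cmod (w s)"
      using nn[OF s] by (simp add: norm_mult b_def)
  next
    show "cmod (z t0 + P t0 $ 1 $ 2) \<le> cmod (w t0)"
      using Z0 by (simp add: z_def)
  qed
  have "0 < a T"
  proof (rule cond4_supersolution_positive[OF c4_1 _ _ T a'])
    show "continuous_on {t0..} (\<lambda>s. Re (P s $ 1 $ 1))" by (intro continuous_intros P)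
    have "continuous_on {t0..} (\<lambda>t. (offdiag_bound P t0 w g3 t)\<^sup>2 - (cmod (P t $ 2 $ 1))\<^sup>2 - Re (Q t $ 1 $ 1))"
      by (intro continuous_intros continuous_on_offdiag_bound P Q cw cg3)
    then show "continuous_on {t0..} (chi3 P Q dp21 t0)" by (simp add: chi3[abs_def])
    show "0 < a t0" using Z0 by (simp add: a_def)
    fix t assume t: "t \<in> {t0..T}"
    have "(cmod (z t + cnj (P t $ 2 $ 1)))\<^sup>2 \<le> (offdiag_bound P t0 w g3 t)\<^sup>2"
      by (rule power_mono[OF u_bd[OF t]]) simp
    then show "- (a t)\<^sup>2 - 2 * Re (P t $ 1 $ 1) * a t - chi3 P Q dp21 t0 t
       \<le> - (a t)\<^sup>2 - 2 * Re (P t $ 1 $ 1) * a t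
      - ((cmod (z t + cnj (P t $ 2 $ 1)))\<^sup>2 - (cmod (P t $ 2 $ 1))\<^sup>2 - Re (Q t $ 1 $ 1))"
      unfolding chi3 by simp
  qed
  moreover have "0 < b T"
  proof (rule cond4_supersolution_positive[OF c4_2 _ _ T b'])
    show "continuous_on {t0..} (\<lambda>s. Re (P s $ 2 $ 2))" by (intro continuous_intros P)
    have "continuous_on {t0..} (\<lambda>t. (offdiag_bound P t0 w g4 t)\<^sup>2 - (cmod (P t $ 1 $ 2))\<^sup>2 - Re (Q t $ 2 $ 2))"
      by (intro continuous_intros continuous_on_offdiag_bound P Q cw cg4)
    then show "continuous_on {t0..} (chi4 P Q dp12 t0)" by (simp add: chi4[abs_def])
    show "0 < b t0" using Z0 by (simp add: b_def)
    fix t assume t: "t \<in> {t0..T}"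
    have "(cmod (z t + P t $ 1 $ 2))\<^sup>2 \<le> (offdiag_bound P t0 w g4 t)\<^sup>2"
      by (rule power_mono[OF v_bd[OF t]]) simp
    then show "- (b t)\<^sup>2 - 2 * Re (P t $ 2 $ 2) * b t - chi4 P Q dp12 t0 t
       \<le> - (b t)\<^sup>2 - 2 * Re (P t $ 2 $ 2) * b t
      - ((cmod (z t + P t $ 1 $ 2))\<^sup>2 - (cmod (P t $ 1 $ 2))\<^sup>2 - Re (Q t $ 2 $ 2))"
      unfolding chi4 by simp
  qed
  ultimately show ?thesis by (simp add: a_def b_def)
qed

text \<open>By Cayley--Hamilton, the adjugate of a 2 by 2 matrix is \<open>trace X - X\<close>.\<close>

definition inv2 :: "complex^2^2 \<Rightarrow> complex^2^2" where
  "inv2 X = mat (1 / det X) ** (mat (trace X) - X)"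

lemma mat_entries2 [simp]:
  "(mat c :: complex^2^2) $ 1 $ 1 = c" "(mat c :: complex^2^2) $ 1 $ 2 = 0"
  "(mat c :: complex^2^2) $ 2 $ 1 = 0" "(mat c :: complex^2^2) $ 2 $ 2 = c"
  by (simp_all add: mat_def)

lemma inv2_mult:
  assumes "det X \<noteq> 0"
  shows "X ** inv2 X = mat 1" "inv2 X ** X = mat 1"
proof -
  have "X ** (mat (trace X) - X) = mat (det X)" "(mat (trace X) - X) ** X = mat (det X)"
    by (simp_all add: matrix2_eq_iff matrix_matrix_mult_def sum_2 trace_def det_2 algebra_simps)
  moreover have "X ** (mat c ** Y) = mat c ** (X ** Y)" for c and Y :: "complex^2^2"
    by (simp add: matrix2_eq_iff matrix_matrix_mult_def sum_2 algebra_simps)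
  moreover have "mat c ** (mat d :: complex^2^2) = mat (c * d)" for c d
    by (simp add: matrix2_eq_iff matrix_matrix_mult_def sum_2)
  ultimately show "X ** inv2 X = mat 1" "inv2 X ** X = mat 1"
    using assms by (simp_all add: inv2_def matrix_mul_assoc[symmetric])
qed

lemma bounded_linear_mat: "bounded_linear (mat :: complex \<Rightarrow> complex^2^2)"
  unfolding linear_conv_bounded_linear[symmetric] linear_iff by (simp add: matrix2_eq_iff)

lemma bounded_linear_trace: "bounded_linear (trace :: complex^2^2 \<Rightarrow> complex)"
  unfolding linear_conv_bounded_linear[symmetric] linear_iff by (simp add: trace_def sum_2 algebra_simps)

lemma has_vector_derivative_inv2:
  fixes X :: "real \<Rightarrow> complex^2^2"
  assumes X: "(X has_vector_derivative M ** X t) (at t within A)" and det: "det (X t) \<noteq> 0"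
  shows "((\<lambda>t. inv2 (X t)) has_vector_derivative - (inv2 (X t) ** M)) (at t within A)"
proof -
  have d: "((\<lambda>t. det (X t)) has_vector_derivative trace M * det (X t)) (at t within A)"
    using has_vector_derivative_det2[of X M t "mat 0" A] X
    by (simp add: trace_def sum_2)
  have "((\<lambda>t. 1 / det (X t)) has_vector_derivative - trace M / det (X t)) (at t within A)"
  proof -
    have "((\<lambda>x. 1 / x) has_field_derivative - (1 / (det (X t))\<^sup>2)) (at (det (X t)) within UNIV)"
      using det by (auto intro!: derivative_eq_intros simp: power2_eq_square)
    then have "((\<lambda>x. 1 / x) has_field_derivative - (1 / (det (X t))\<^sup>2)) (at (det (X t)) within ((\<lambda>t. det (X t)) ` A))"
      by (rule DERIV_subset) simp
    from field_vector_diff_chain_within[OF d this] show ?thesis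
      using det by (simp add: comp_def power2_eq_square)
  qed
  from has_vector_derivative_matrix_mult[OF bounded_linear.has_vector_derivative[OF bounded_linear_mat this]
      has_vector_derivative_diff[OF bounded_linear.has_vector_derivative[OF bounded_linear_mat
        bounded_linear.has_vector_derivative[OF bounded_linear_trace X]] X]]
  show ?thesis
    unfolding inv2_def
    by (rule has_vector_derivative_eq_rhs)
      (simp add: matrix2_eq_iff matrix_matrix_mult_def sum_2 trace_def det field_simps)
qed

text \<open>The Riccati equation is linearized by a Hamiltonian system whose coefficient
  \<open>B\<close> is the identity, with globally defined \<open>X\<close> and \<open>V\<close>. It
  remains to show that \<open>det (X t)\<close> never vanishes: up to a first zero the diagonal of
  \<open>Z\<close> is positive, so the logarithmic derivative of the squared modulus of the
  determinant is bounded below by that coming from \<open>P\<close> alone.\<close>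

lemma riccati_global:
  fixes P Q :: "real \<Rightarrow> complex^2^2" and dp12 dp21 :: "real \<Rightarrow> complex"
  assumes P: "continuous_on {t0..} P" and Q: "continuous_on {t0..} Q"
    and hermQ: "\<And>t. t \<ge> t0 \<Longrightarrow> cadj (Q t) = Q t"
    and d12: "\<forall>t\<ge>t0. ((\<lambda>s. P s $ 1 $ 2) has_vector_derivative dp12 t) (at t within {t0..})"
    and c12: "continuous_on {t0..} dp12"
    and d21: "\<forall>t\<ge>t0. ((\<lambda>s. P s $ 2 $ 1) has_vector_derivative dp21 t) (at t within {t0..})"
    and c21: "continuous_on {t0..} dp21"
    and c4_1: "cond4 (\<lambda>s. Re (P s $ 1 $ 1)) (chi3 P Q dp21 t0) t0"
    and c4_2: "cond4 (\<lambda>s. Re (P s $ 2 $ 2)) (chi4 P Q dp12 t0) t0"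
  obtains Z where "\<And>t. t \<ge> t0 \<Longrightarrow> cadj (Z t) = Z t"
    "\<And>t. t \<ge> t0 \<Longrightarrow> (Z has_vector_derivative riccati_rhs (P t) (Q t) (Z t)) (at t within {t0..})"
proof -
  obtain X V where sol: "ham_matrix_solution P (\<lambda>_. mat 1) Q t0 X V"
    and X0: "X t0 = mat 1" and V0: "V t0 = herm2 1 (- P t0 $ 1 $ 2) 1"
    using ham_matrix_solution_exists[OF P continuous_on_const Q] by blast
  have X': "(X has_vector_derivative P t ** X t + V t) (at t within {t0..})"
    and V': "(V has_vector_derivative Q t ** X t - cadj (P t) ** V t) (at t within {t0..})" if "t \<ge> t0" for t
    using sol that by (auto simp: ham_matrix_solution_def)
  have conj: "cadj (X t) ** V t = cadj (V t) ** X t" if "t \<ge> t0" for t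
    using ham_matrix_solution_conjoined[OF sol] hermQ that by (auto simp: X0 V0 conjoined_def)
  define Z where "Z t = V t ** inv2 (X t)" for t
  have ZX: "Z t ** X t = V t" if "det (X t) \<noteq> 0" for t
    using inv2_mult(2)[OF that] by (simp add: Z_def matrix_mul_assoc[symmetric])
  \<comment> \<open>This is the conjoined property multiplied by the inverse of \<open>X t\<close>
    on the right and by its adjoint on the left.\<close>
  have herm: "cadj (Z t) = Z t" if t: "t \<ge> t0" and det: "det (X t) \<noteq> 0" for t
  proof -
    let ?Y = "inv2 (X t)"
    have "cadj ?Y ** cadj (X t) = mat 1"
      using inv2_mult(1)[OF det] by (metis cadj_mult cadj_mat complex_cnj_one)
    then have "Z t = cadj ?Y ** (cadj (X t) ** V t) ** ?Y" by (simp add: Z_def matrix_mul_assoc)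
    also have "\<dots> = cadj ?Y ** cadj (V t)"
      unfolding conj[OF t] using inv2_mult(1)[OF det] by (simp add: matrix_mul_assoc[symmetric])
    finally show ?thesis by (simp add: Z_def cadj_mult)
  qed
  have X'': "(X has_vector_derivative (P t + Z t) ** X t) (at t within {t0..})"
    if "t \<ge> t0" "det (X t) \<noteq> 0" for t
    using X'[OF that(1)] ZX[OF that(2)] by (simp add: matrix_mult_algebra)
  have Z': "(Z has_vector_derivative riccati_rhs (P t) (Q t) (Z t)) (at t within {t0..})"
    if t: "t \<ge> t0" and det: "det (X t) \<noteq> 0" for t
    unfolding Z_def[abs_def]
    by (rule has_vector_derivative_eq_rhs[OF has_vector_derivative_matrix_mult[OF V'[OF t]
          has_vector_derivative_inv2[OF X''[OF t det] det]]])
      (simp add: riccati_rhs_def Z_def matrix_mult_algebra inv2_mult[OF det])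
  have cX: "continuous_on {t0..} X" by (rule has_vector_derivative_imp_continuous_on[OF X']) simp
  have det_ne: "det (X t1) \<noteq> 0" if t1: "t1 \<ge> t0" for t1
  proof
    assume "det (X t1) = 0"
    have "continuous_on {t0..t1} (\<lambda>t. cmod (det (X t)))"
      unfolding det_2 by (intro continuous_intros continuous_on_subset[OF cX]) auto
    moreover have "cmod (det (X t0)) > 0" by (simp add: X0)
    moreover have "\<exists>t\<in>{t0..t1}. cmod (det (X t)) \<le> 0" using \<open>det (X t1) = 0\<close> t1 by auto
    ultimately obtain T where T: "T \<in> {t0..t1}" "det (X T) = 0"
      and ne: "\<And>t. t0 \<le> t \<Longrightarrow> t < T \<Longrightarrow> det (X t) \<noteq> 0"
      using first_zero[of t0 t1 "\<lambda>t. cmod (det (X t))"] by (metis norm_eq_zero zero_less_norm_iff)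
    have pos: "0 < Re (Z t $ 1 $ 1) \<and> 0 < Re (Z t $ 2 $ 2)" if t: "t0 \<le> t" "t < T" for t
    proof (rule ccontr)
      assume neg: "\<not> ?thesis"
      \<comment> \<open>The minimum vanishes at a first time \<open>T'\<close>, up to which both
        entries are nonnegative; strict positivity of both at \<open>T'\<close> is the
        contradiction.\<close>
      define f where "f s = min (Re (Z s $ 1 $ 1)) (Re (Z s $ 2 $ 2))" for s
      have cZ: "continuous_on {t0..t} Z"
        by (rule has_vector_derivative_imp_continuous_on)
          (use t ne in \<open>auto intro!: has_vector_derivative_within_subset[OF Z']\<close>)
      have inv1: "inv2 (X t0) = mat 1"
        using inv2_mult(1)[of "X t0"] by (simp add: X0)
      have Z0: "Z t0 = herm2 1 (- P t0 $ 1 $ 2) 1" by (simp add: Z_def inv1 V0)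
      have "continuous_on {t0..t} f" unfolding f_def by (intro continuous_intros cZ)
      moreover have "f t0 > 0" by (simp add: f_def Z0)
      moreover have "\<exists>s\<in>{t0..t}. f s \<le> 0" using neg t by (intro bexI[of _ t]) (auto simp: f_def)
      ultimately obtain T' where T': "T' \<in> {t0..t}" "f T' = 0" "\<And>s. t0 \<le> s \<Longrightarrow> s < T' \<Longrightarrow> f s > 0"
        using first_zero[of t0 t f] by metis
      have "0 < Re (Z T' $ 1 $ 1) \<and> 0 < Re (Z T' $ 2 $ 2)"
      proof (rule riccati_diag_positive[OF P Q d12 c12 d21 c21 c4_1 c4_2])
        show "t0 \<le> T'" using T' by simp
        show "Z t0 = herm2 1 (- P t0 $ 1 $ 2) 1" by (rule Z0)
        fix s assume s: "s \<in> {t0..T'}"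
        then have ds: "s \<ge> t0" "det (X s) \<noteq> 0" using ne[of s] T' t by auto
        show "(Z has_vector_derivative riccati_rhs (P s) (Q s) (Z s)) (at s within {t0..T'})"
          by (rule has_vector_derivative_within_subset[OF Z'[OF ds]]) auto
        show "cadj (Z s) = Z s" by (rule herm[OF ds])
        have "f s \<ge> 0" using T'(2) T'(3)[of s] s by (cases "s = T'") auto
        then show "0 \<le> Re (Z s $ 1 $ 1) \<and> 0 \<le> Re (Z s $ 2 $ 2)" by (simp add: f_def)
      qed
      with T'(2) show False by (simp add: f_def min_def split: if_splits)
    qed
    let ?d = "\<lambda>t. det (X t)"
    define dd where "dd t = (if t = T then 0 else 2 * (Re (trace (P t + Z t)) * (?d t \<bullet> ?d t)))" for t
    have cP: "continuous_on {t0..T} P" by (rule continuous_on_subset[OF P]) auto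
    \<comment> \<open>The left side is 1, whereas a zero of the determinant at \<open>T\<close>
      would make the right side 0.\<close>
    have "?d t0 \<bullet> ?d t0 \<le> exp (integral {t0..T} (\<lambda>t. - 2 * Re (trace (P t)))) * (?d T \<bullet> ?d T)"
    proof (rule linear_differential_inequality)
      show "t0 \<le> T" using T by simp
      show "continuous_on {t0..T} (\<lambda>t. - 2 * Re (trace (P t)))"
        unfolding trace_def sum_2 by (intro continuous_intros cP)
      fix t assume t: "t \<in> {t0..T}"
      have d: "(?d has_vector_derivative d') (at t within {t0..T}) \<Longrightarrow>
          ((\<lambda>t. ?d t \<bullet> ?d t) has_vector_derivative 2 * (?d t \<bullet> d')) (at t within {t0..T})" for d'
        by (rule has_vector_derivative_eq_rhs[OF bounded_bilinear.has_vector_derivative[OF bounded_bilinear_inner]])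
          (auto simp: inner_commute)
      show "((\<lambda>t. ?d t \<bullet> ?d t) has_vector_derivative dd t) (at t within {t0..T})"
      proof (cases "t = T")
        case True
        have x: "(X has_vector_derivative P t ** X t + V t) (at t within {t0..T})"
          by (rule has_vector_derivative_within_subset[OF X']) (use t in auto)
        note e = has_vector_derivative_matrix_entry[OF x]
        have "\<exists>d'. (?d has_vector_derivative d') (at t within {t0..T})"
          unfolding det_2
          using has_vector_derivative_diff[OF has_vector_derivative_mult[OF e e] has_vector_derivative_mult[OF e e]]
          by blast
        then obtain d' where "(?d has_vector_derivative d') (at t within {t0..T})" by blast
        from d[OF this] show ?thesis using True T by (simp add: dd_def)
      next
        case False
        then have ds: "t \<ge> t0" "det (X t) \<noteq> 0" using ne[of t] t by auto
        have "(X has_vector_derivative (P t + Z t) ** X t + X t ** mat 0) (at t within {t0..T})"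
          using has_vector_derivative_within_subset[OF X''[OF ds], of "{t0..T}"] by (simp add: subset_iff)
        from d[OF has_vector_derivative_det2[OF this]]
        have "((\<lambda>t. ?d t \<bullet> ?d t) has_vector_derivative
            2 * (?d t \<bullet> (trace (P t + Z t) * ?d t))) (at t within {t0..T})"
          by (simp add: trace_def sum_2)
        moreover have "x \<bullet> (c * x) = Re c * (x \<bullet> x)" for x c :: complex
          by (simp add: inner_complex_def algebra_simps)
        ultimately show ?thesis using False by (simp add: dd_def)
      qed
      show "- (- 2 * Re (trace (P t))) * (?d t \<bullet> ?d t) \<le> dd t"
      proof (cases "t = T")
        case True then show ?thesis using T by (simp add: dd_def)
      next
        case False
        then have "Re (trace (P t)) \<le> Re (trace (P t + Z t))"
          using pos[of t] t by (simp add: trace_def sum_2)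
        then have "Re (trace (P t)) * (?d t \<bullet> ?d t) \<le> Re (trace (P t + Z t)) * (?d t \<bullet> ?d t)"
          by (rule mult_right_mono) simp
        then show ?thesis using False by (simp add: dd_def)
      qed
    qed
    then show False using T by (simp add: X0)
  qed
  from that[of Z] show thesis using herm Z' det_ne by blast
qed

section \<open>Transfer to the Hamiltonian system\<close>

lemma linear_matrix_vector_mult: "linear ((*v) (M :: complex^'n^'m))"
  by (rule bounded_linear.linear[OF bounded_bilinear.bounded_linear_right[OF bounded_bilinear_matrix_vector_mult]])

lemma bounded_linear_vector_scalar_mult: "bounded_linear ((*s) (c :: complex) :: complex^'n \<Rightarrow> complex^'n)"
  unfolding linear_conv_bounded_linear[symmetric] linear_iff
  by (simp add: vec_eq_iff algebra_simps scaleR_conv_of_real)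

lemma vector_ode_solution:
  fixes P :: "real \<Rightarrow> complex^2^2" and s :: "real \<Rightarrow> complex^2"
  assumes P: "continuous_on {t1..} P" and s: "continuous_on {t1..} s"
  shows "\<exists>X. X t1 = c \<and> (\<forall>t\<ge>t1. (X has_vector_derivative (P t *v X t + s t)) (at t within {t1..}))"
  by (rule linear_ode_solution[where L = "\<lambda>t. (*v) (P t)"])
    (intro linear_matrix_vector_mult continuous_intros P s)+

lemma vector_ode_unique:
  fixes P :: "real \<Rightarrow> complex^2^2" and y :: "real \<Rightarrow> complex^2"
  assumes P: "continuous_on {t1..} P"
    and y: "\<And>t. t \<ge> t1 \<Longrightarrow> (y has_vector_derivative (P t *v y t)) (at t within {t1..})"
    and s: "s \<ge> t1" "y s = 0" and t: "t \<ge> t1"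
  shows "y t = 0"
  by (rule linear_ode_unique[where L = "\<lambda>t. (*v) (P t)", OF _ _ y s t])
    (intro linear_matrix_vector_mult continuous_intros P)+

text \<open>The kernel of a nonzero matrix is at most a line: a nonzero row annihilates both
  vectors, so the determinant formed from them vanishes, and a nonzero coordinate supplies the
  coefficients.\<close>

lemma two_kernel_vectors_dependent:
  fixes M :: "complex^2^2"
  assumes "M \<noteq> 0" "M *v x = 0" "M *v y = 0"
  obtains a b where "a \<noteq> 0 \<or> b \<noteq> 0" "a *s x + b *s y = 0"
proof -
  obtain i j where "M $ i $ j \<noteq> 0" using assms(1) by (auto simp: vec_eq_iff)
  then have r: "M $ i $ 1 \<noteq> 0 \<or> M $ i $ 2 \<noteq> 0" using exhaust_2[of j] by auto
  have "(M *v x) $ i = 0" "(M *v y) $ i = 0" using assms by simp_all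
  then have x: "M $ i $ 1 * x $ 1 + M $ i $ 2 * x $ 2 = 0" and y: "M $ i $ 1 * y $ 1 + M $ i $ 2 * y $ 2 = 0"
    by (simp_all add: matrix_vector_mult_def sum_2)
  have "M $ i $ 1 * (x $ 1 * y $ 2 - x $ 2 * y $ 1) =
      (M $ i $ 1 * x $ 1 + M $ i $ 2 * x $ 2) * y $ 2 - (M $ i $ 1 * y $ 1 + M $ i $ 2 * y $ 2) * x $ 2"
    by (simp add: algebra_simps)
  moreover have "M $ i $ 2 * (x $ 1 * y $ 2 - x $ 2 * y $ 1) =
      (M $ i $ 1 * y $ 1 + M $ i $ 2 * y $ 2) * x $ 1 - (M $ i $ 1 * x $ 1 + M $ i $ 2 * x $ 2) * y $ 1"
    by (simp add: algebra_simps)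
  ultimately have d: "x $ 1 * y $ 2 - x $ 2 * y $ 1 = 0" using r x y by auto
  show thesis
  proof (cases "x = 0")
    case True then show thesis using that[of 1 0] by simp
  next
    case False
    then consider "x $ 1 \<noteq> 0" | "x $ 2 \<noteq> 0" by (auto simp: vec_eq_iff forall_2)
    then show thesis
    proof cases
      case 1 then show thesis using that[of "y $ 1" "- x $ 1"] d
        by (simp add: vec_eq_iff forall_2 algebra_simps)
    next
      case 2 then show thesis using that[of "y $ 2" "- x $ 2"] d
        by (simp add: vec_eq_iff forall_2 algebra_simps)
    qed
  qed
qed

text \<open>Real orthogonality to both \<open>f\<close> and \<open>\<i> *s f\<close> amounts to
  complex orthogonality to \<open>f\<close>, and the complex orthogonal complement in dimension two
  is a line.\<close>

lemma orthogonal_complement_line: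
  fixes f :: "complex^2"
  assumes "f \<noteq> 0"
  obtains e where "e \<noteq> 0" "\<And>c. f \<bullet> c = 0 \<Longrightarrow> (\<i> *s f) \<bullet> c = 0 \<Longrightarrow> \<exists>k. c = k *s e"
proof -
  define e :: "complex^2" where "e = (\<chi> i. if i = 1 then - cnj (f $ 2) else cnj (f $ 1))"
  have e: "e $ 1 = - cnj (f $ 2)" "e $ 2 = cnj (f $ 1)" by (simp_all add: e_def)
  have nz: "f $ 1 \<noteq> 0 \<or> f $ 2 \<noteq> 0" using assms by (auto simp: vec_eq_iff forall_2)
  have "\<exists>k. c = k *s e" if "f \<bullet> c = 0" "(\<i> *s f) \<bullet> c = 0" for c
  proof -
    have 0: "cnj (f $ 1) * c $ 1 + cnj (f $ 2) * c $ 2 = 0"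
      using that by (simp add: inner_vec_def sum_2 inner_complex_eq_Re complex_eq_iff algebra_simps)
    show ?thesis
    proof (cases "f $ 1 = 0")
      case True
      then show ?thesis using 0 nz
        by (intro exI[of _ "- c $ 1 / cnj (f $ 2)"]) (simp add: vec_eq_iff forall_2 e)
    next
      case False
      then show ?thesis using 0
        by (intro exI[of _ "c $ 2 / cnj (f $ 1)"])
          (simp add: vec_eq_iff forall_2 e field_simps eq_neg_iff_add_eq_0)
    qed
  qed
  moreover have "e \<noteq> 0" using nz e by (auto simp: vec_eq_iff forall_2)
  ultimately show thesis by (rule that[rotated])
qed

lemma ham_matrix_solution_cong:
  assumes "\<And>t. t \<ge> t0 \<Longrightarrow> B t = B' t"
  shows "ham_matrix_solution A B C t0 \<Phi> \<Psi> \<longleftrightarrow> ham_matrix_solution A B' C t0 \<Phi> \<Psi>"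
  using assms by (auto simp: ham_matrix_solution_def)

text \<open>The coefficient \<open>B\<close> is represented as \<open>S ** S\<close>, and the
  condition on \<open>F\<close> by the equation for the derivative of \<open>S\<close>. The rank of
  \<open>S\<close> is left open, so \<open>Z\<close> need not come from a Riccati solution of the
  original system.\<close>

locale factored_hamiltonian =
  fixes A C S P Z :: "real \<Rightarrow> complex^2^2" and t0 :: real
  assumes contA: "continuous_on {t0..} A" and contC: "continuous_on {t0..} C"
    and contP: "continuous_on {t0..} P"
    and hermC: "t \<ge> t0 \<Longrightarrow> cadj (C t) = C t"
    and hermS: "t \<ge> t0 \<Longrightarrow> cadj (S t) = S t"
    and hermZ: "t \<ge> t0 \<Longrightarrow> cadj (Z t) = Z t"
    and S': "t \<ge> t0 \<Longrightarrow> (S has_vector_derivative (A t ** S t - S t ** P t)) (at t within {t0..})"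
    and Z': "t \<ge> t0 \<Longrightarrow>
      (Z has_vector_derivative riccati_rhs (P t) (S t ** C t ** S t) (Z t)) (at t within {t0..})"
begin

section \<open>The equation for \<open>S\<close> and the constancy of its rank\<close>

lemma contS: "continuous_on {t0..} S"
  by (rule has_vector_derivative_imp_continuous_on[OF S']) simp

lemma contZ: "continuous_on {t0..} Z"
  by (rule has_vector_derivative_imp_continuous_on[OF Z']) simp

text \<open>The adjoint of the equation for the Hermitian \<open>S\<close>. In this form the terms
  with the adjoint of \<open>A\<close> cancel when \<open>S t *v \<psi> t\<close> is
  differentiated.\<close>

lemma S'_adj: "(S has_vector_derivative (S t ** cadj (A t) - cadj (P t) ** S t)) (at t within {t0..})"
  if t: "t \<ge> t0"
proof -
  have "((\<lambda>t. cadj (S t)) has_vector_derivative cadj (A t ** S t - S t ** P t)) (at t within {t0..})"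
    by (rule has_vector_derivative_cadj[OF S'[OF t]])
  then have "(S has_vector_derivative cadj (A t ** S t - S t ** P t)) (at t within {t0..})"
    by (rule has_vector_derivative_transform[rotated 2]) (use t hermS in auto)
  then show ?thesis by (simp add: cadj_linear cadj_mult hermS[OF t])
qed

text \<open>The determinant solves a homogeneous scalar linear equation, so a zero at any time
  propagates back to \<open>t0\<close>.\<close>

lemma det_S_nonzero:
  assumes "det (S t0) \<noteq> 0" "t \<ge> t0"
  shows "det (S t) \<noteq> 0"
proof
  assume "det (S t) = 0"
  have "det (S t0) = 0"
  proof (rule linear_ode_unique[where L = "\<lambda>t x. (trace (A t) + trace (- P t)) * x"])
    fix t assume t: "t \<ge> t0"
    have "(S has_vector_derivative (A t ** S t + S t ** (- P t))) (at t within {t0..})"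
      using S'[OF t] by (simp add: matrix_mult_algebra)
    then show "((\<lambda>t. det (S t)) has_vector_derivative (trace (A t) + trace (- P t)) * det (S t)) (at t within {t0..})"
      by (rule has_vector_derivative_det2)
    show "linear ((*) (trace (A t) + trace (- P t)))"
      by (rule bounded_linear.linear[OF bounded_linear_mult_right])
  next
    show "continuous_on {t0..} (\<lambda>t. (trace (A t) + trace (- P t)) * x)" for x
      unfolding trace_def sum_2 by (intro continuous_intros contA contP)
  qed (use assms \<open>det (S t) = 0\<close> in auto)
  then show False using assms by simp
qed

lemma S_zero:
  assumes "s \<ge> t0" "S s = 0" "t \<ge> t0"
  shows "S t = 0"
proof (rule linear_ode_unique[where L = "\<lambda>t X. A t ** X - X ** P t", OF _ _ S' assms])
  show "linear (\<lambda>X. A t ** X - X ** P t)" for t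
    by (intro linear_compose_sub bounded_linear.linear
        bounded_bilinear.bounded_linear_right[OF bounded_bilinear_matrix_mult]
        bounded_bilinear.bounded_linear_left[OF bounded_bilinear_matrix_mult])
  show "continuous_on {t0..} (\<lambda>t. A t ** X - X ** P t)" for X
    by (intro continuous_intros contA contP)
qed

section \<open>Vector solutions, their lifts through \<open>S\<close>, and the energy\<close>

definition vsol :: "(real \<Rightarrow> complex^2) \<Rightarrow> (real \<Rightarrow> complex^2) \<Rightarrow> bool" where
  "vsol \<phi> \<psi> \<longleftrightarrow> (\<forall>t\<ge>t0.
     (\<phi> has_vector_derivative (A t *v \<phi> t + S t *v (S t *v \<psi> t))) (at t within {t0..}) \<and>
     (\<psi> has_vector_derivative (C t *v \<phi> t - cadj (A t) *v \<psi> t)) (at t within {t0..}))"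

lemma vsolD:
  assumes "vsol \<phi> \<psi>" "t \<ge> t0"
  shows "(\<phi> has_vector_derivative (A t *v \<phi> t + S t *v (S t *v \<psi> t))) (at t within {t0..})"
    "(\<psi> has_vector_derivative (C t *v \<phi> t - cadj (A t) *v \<psi> t)) (at t within {t0..})"
  using assms by (auto simp: vsol_def)

lemma vsol_scale:
  assumes "vsol \<phi> \<psi>"
  shows "vsol (\<lambda>t. c *s \<phi> t) (\<lambda>t. c *s \<psi> t)"
  unfolding vsol_def
proof (intro allI impI conjI)
  fix t assume t: "t \<ge> t0"
  note d = bounded_linear.has_vector_derivative[OF bounded_linear_vector_scalar_mult, of _ _ _ c]
  show "((\<lambda>t. c *s \<phi> t) has_vector_derivative (A t *v (c *s \<phi> t) + S t *v (S t *v (c *s \<psi> t)))) (at t within {t0..})"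
    by (rule has_vector_derivative_eq_rhs[OF d[OF vsolD(1)[OF assms t]]])
      (simp add: vector_scalar_commute vector_add_ldistrib)
  show "((\<lambda>t. c *s \<psi> t) has_vector_derivative (C t *v (c *s \<phi> t) - cadj (A t) *v (c *s \<psi> t))) (at t within {t0..})"
    by (rule has_vector_derivative_eq_rhs[OF d[OF vsolD(2)[OF assms t]]])
      (simp add: vector_scalar_commute vector_ssub_ldistrib)
qed

lemma vsol_continuous:
  assumes "vsol \<phi> \<psi>"
  shows "continuous_on {t0..} \<phi>" "continuous_on {t0..} \<psi>"
  by (rule has_vector_derivative_imp_continuous_on, rule vsolD[OF assms], simp)+

lemma vsol_zero: "vsol (\<lambda>_. 0) (\<lambda>_. 0)"
  by (auto simp: vsol_def matrix_vector_algebra)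

lemma ham_matrix_solution_vsol:
  assumes "ham_matrix_solution A (\<lambda>t. S t ** S t) C t0 \<Phi> \<Psi>"
  shows "vsol (\<lambda>t. \<Phi> t *v c) (\<lambda>t. \<Psi> t *v c)"
  unfolding vsol_def
proof (intro allI impI conjI)
  fix t assume t: "t \<ge> t0"
  note d = assms[unfolded ham_matrix_solution_def, rule_format, OF t]
  show "((\<lambda>t. \<Phi> t *v c) has_vector_derivative (A t *v (\<Phi> t *v c) + S t *v (S t *v (\<Psi> t *v c)))) (at t within {t0..})"
    by (rule has_vector_derivative_eq_rhs[OF has_vector_derivative_matrix_vector_mult[OF
        conjunct1[OF d] has_vector_derivative_const]])
      (simp add: matrix_vector_algebra)
  show "((\<lambda>t. \<Psi> t *v c) has_vector_derivative (C t *v (\<Phi> t *v c) - cadj (A t) *v (\<Psi> t *v c))) (at t within {t0..})"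
    by (rule has_vector_derivative_eq_rhs[OF has_vector_derivative_matrix_vector_mult[OF
        conjunct2[OF d] has_vector_derivative_const]])
      (simp add: matrix_vector_algebra)
qed

text \<open>By the equation for \<open>S\<close> the difference of the two sides solves the
  homogeneous equation with coefficient \<open>A\<close>.\<close>

lemma lift_eq:
  assumes v: "vsol \<phi> \<psi>" and t1: "t1 \<ge> t0"
    and X: "\<And>t. t \<ge> t1 \<Longrightarrow> (X has_vector_derivative (P t *v X t + S t *v \<psi> t)) (at t within {t1..})"
    and init: "S t1 *v X t1 = \<phi> t1" and t: "t \<ge> t1"
  shows "S t *v X t = \<phi> t"
proof -
  have sub: "{t1..} \<subseteq> {t0..}" using t1 by auto
  have "S t *v X t - \<phi> t = 0"
  proof (rule vector_ode_unique[OF continuous_on_subset[OF contA sub] _ order_refl _ t])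
    show "S t1 *v X t1 - \<phi> t1 = 0" using init by simp
    fix s assume s: "s \<ge> t1"
    then have s0: "s \<ge> t0" using t1 by simp
    show "((\<lambda>t. S t *v X t - \<phi> t) has_vector_derivative A s *v (S s *v X s - \<phi> s)) (at s within {t1..})"
      by (rule has_vector_derivative_eq_rhs[OF has_vector_derivative_diff[OF
          has_vector_derivative_matrix_vector_mult[OF has_vector_derivative_within_subset[OF S'[OF s0] sub] X[OF s]]
          has_vector_derivative_within_subset[OF vsolD(1)[OF v s0] sub]]])
        (simp add: matrix_vector_algebra)
  qed
  then show ?thesis by simp
qed

text \<open>The terms with \<open>A\<close> and with \<open>P\<close> cancel, and the term with
  \<open>C\<close> cancels against the inhomogeneity of the Riccati equation because the lift
  represents \<open>\<phi>\<close>. The remaining terms form a complete square.\<close>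

lemma energy_derivative:
  assumes v: "vsol \<phi> \<psi>" and ab: "t0 \<le> a"
    and X: "\<And>t. t \<in> {a..b} \<Longrightarrow> (X has_vector_derivative (P t *v X t + S t *v \<psi> t)) (at t within {a..b})"
    and lift: "\<And>t. t \<in> {a..b} \<Longrightarrow> S t *v X t = \<phi> t"
    and t: "t \<in> {a..b}"
  shows "((\<lambda>t. \<psi> t \<bullet> \<phi> t - X t \<bullet> (Z t *v X t)) has_vector_derivative
     (norm (S t *v \<psi> t - Z t *v X t))\<^sup>2) (at t within {a..b})"
proof -
  have sub: "{a..b} \<subseteq> {t0..}" and t0: "t \<ge> t0" using t ab by auto
  note ip = bounded_bilinear.has_vector_derivative[OF bounded_bilinear_inner]
  note r = has_vector_derivative_within_subset[OF _ sub]
  let ?A = "A t" and ?C = "C t" and ?S = "S t" and ?P = "P t" and ?Z = "Z t"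
    and ?x = "X t" and ?p = "\<phi> t" and ?q = "\<psi> t"
  have a: "x \<bullet> (M *v y) = (cadj M *v x) \<bullet> y" for x y and M :: "complex^2^2"
    using inner_cadj[of "cadj M" x y] by simp
  have p: "?p = ?S *v ?x" using lift[OF t] by simp
  have "((\<lambda>t. \<psi> t \<bullet> \<phi> t - X t \<bullet> (Z t *v X t)) has_vector_derivative
     (?q \<bullet> (?A *v ?p + ?S *v (?S *v ?q)) + (?C *v ?p - cadj ?A *v ?q) \<bullet> ?p) -
     (?x \<bullet> (?Z *v (?P *v ?x + ?S *v ?q) + riccati_rhs ?P (?S ** ?C ** ?S) ?Z *v ?x)
       + (?P *v ?x + ?S *v ?q) \<bullet> (?Z *v ?x))) (at t within {a..b})"
    by (rule has_vector_derivative_diff[OF ip[OF r[OF vsolD(2)[OF v t0]] r[OF vsolD(1)[OF v t0]]]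
          ip[OF X[OF t] has_vector_derivative_matrix_vector_mult[OF r[OF Z'[OF t0]] X[OF t]]]])
  moreover have "(?q \<bullet> (?A *v ?p + ?S *v (?S *v ?q)) + (?C *v ?p - cadj ?A *v ?q) \<bullet> ?p)
      = (?S *v ?q) \<bullet> (?S *v ?q) + (?C *v ?p) \<bullet> ?p"
    by (simp add: inner_add_right inner_diff_left a hermS[OF t0])
  moreover have "?x \<bullet> (?Z *v (?P *v ?x + ?S *v ?q) + riccati_rhs ?P (?S ** ?C ** ?S) ?Z *v ?x)
       + (?P *v ?x + ?S *v ?q) \<bullet> (?Z *v ?x)
      = 2 * ((?S *v ?q) \<bullet> (?Z *v ?x)) + (?C *v ?p) \<bullet> ?p - (?Z *v ?x) \<bullet> (?Z *v ?x)"
  proof -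
    have 1: "?x \<bullet> (?Z *v y) = (?Z *v ?x) \<bullet> y" for y by (simp add: a hermZ[OF t0])
    have 2: "?x \<bullet> (?S *v (?C *v (?S *v ?x))) = (?C *v ?p) \<bullet> ?p"
      unfolding p by (simp add: a hermS[OF t0] hermC[OF t0])
    have 3: "?x \<bullet> (cadj ?P *v (?Z *v ?x)) = (?P *v ?x) \<bullet> (?Z *v ?x)" by (simp add: a)
    show ?thesis
      unfolding riccati_rhs_def
      by (simp add: matrix_vector_algebra inner_add_right inner_diff_right inner_add_left 1 2 3)
        (simp add: inner_commute)
  qed
  moreover have "(norm (?S *v ?q - ?Z *v ?x))\<^sup>2 = (?S *v ?q) \<bullet> (?S *v ?q)
      - 2 * ((?S *v ?q) \<bullet> (?Z *v ?x)) + (?Z *v ?x) \<bullet> (?Z *v ?x)"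
    by (simp add: power2_norm_eq_inner inner_diff_left inner_diff_right inner_commute)
  ultimately show ?thesis by (elim has_vector_derivative_eq_rhs) simp
qed

lemma energy_mono:
  assumes v: "vsol \<phi> \<psi>" and ab: "t0 \<le> a" "a \<le> b"
    and X: "\<And>t. t \<in> {a..b} \<Longrightarrow> (X has_vector_derivative (P t *v X t + S t *v \<psi> t)) (at t within {a..b})"
    and lift: "\<And>t. t \<in> {a..b} \<Longrightarrow> S t *v X t = \<phi> t"
  shows "\<psi> a \<bullet> \<phi> a - X a \<bullet> (Z a *v X a) \<le> \<psi> b \<bullet> \<phi> b - X b \<bullet> (Z b *v X b)"
  by (rule vector_derivative_nonneg_imp_mono[OF ab(2) energy_derivative[OF v ab(1) X lift]]) auto

text \<open>A monotone energy that does not end above its start is constant, so the square in its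
  derivative vanishes. Then \<open>S t *v \<psi> t = Z t *v X t\<close> turns the equation of
  \<open>X\<close> into a homogeneous one with coefficient \<open>P + Z\<close> and zero initial
  value.\<close>

lemma energy_rigid:
  assumes v: "vsol \<phi> \<psi>" and ab: "t0 \<le> a" "a < b"
    and X: "\<And>t. t \<in> {a..b} \<Longrightarrow> (X has_vector_derivative (P t *v X t + S t *v \<psi> t)) (at t within {a..b})"
    and lift: "\<And>t. t \<in> {a..b} \<Longrightarrow> S t *v X t = \<phi> t"
    and Xa: "X a = 0"
    and le: "\<psi> b \<bullet> \<phi> b - X b \<bullet> (Z b *v X b) \<le> \<psi> a \<bullet> \<phi> a - X a \<bullet> (Z a *v X a)"
    and t: "t \<in> {a..b}"
  shows "X t = 0" "S t *v \<psi> t = 0"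
proof -
  define W where "W t = \<psi> t \<bullet> \<phi> t - X t \<bullet> (Z t *v X t)" for t
  have W': "(W has_vector_derivative (norm (S t *v \<psi> t - Z t *v X t))\<^sup>2) (at t within {a..b})" if "t \<in> {a..b}" for t
    unfolding W_def by (rule energy_derivative[OF v ab(1) X lift that])
  have mono: "W p \<le> W q" if "p \<in> {a..b}" "q \<in> {a..b}" "p \<le> q" for p q
    by (rule vector_derivative_nonneg_imp_mono[OF that(3) has_vector_derivative_within_subset[OF W']])
      (use that in auto)
  have const: "W x = W a" if "x \<in> {a..b}" for x
    using mono[of a x] mono[of x b] that le ab by (auto simp: W_def)
  have eq: "S x *v \<psi> x = Z x *v X x" if x: "x \<in> {a..b}" for x
  proof -
    have "(W has_vector_derivative 0) (at x within {a..b})"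
      by (rule has_vector_derivative_transform[of x "{a..b}" W "\<lambda>_. W a" 0, OF x const])
        (assumption, rule has_vector_derivative_const)
    with W'[OF x] have "(norm (S x *v \<psi> x - Z x *v X x))\<^sup>2 = 0"
      using vector_derivative_unique_within_closed_interval[of a b x W] x ab(2) unfolding cbox_interval by blast
    then show ?thesis by simp
  qed
  have "continuous_on {t0..} (\<lambda>t. P t + Z t)" by (intro continuous_intros contP contZ)
  then have "\<exists>K. \<forall>t\<in>{t0..b}. \<forall>x. norm ((P t + Z t) *v x) \<le> K * norm x"
    by (intro linear_family_bound[where L = "\<lambda>t. (*v) (P t + Z t)"] linear_matrix_vector_mult
        continuous_on_matrix_vector_mult continuous_on_const)
  then obtain K where K: "\<And>t x. t \<in> {t0..b} \<Longrightarrow> norm ((P t + Z t) *v x) \<le> K * norm x" by blast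
  have X0: "X x = 0" if "x \<in> {a..b}" for x
  proof (rule linear_ode_zero_Icc[where y = X and s = a and K = K and D = "\<lambda>t. (P t + Z t) *v X t"])
    show "(X has_vector_derivative (P t + Z t) *v X t) (at t within {a..b})" if "t \<in> {a..b}" for t
      using X[OF that] eq[OF that] by (simp add: matrix_vector_algebra)
  qed (use that Xa ab K in auto)
  show "X t = 0" by (rule X0[OF t])
  then show "S t *v \<psi> t = 0" using eq[OF t] by (simp add: matrix_vector_algebra)
qed

section \<open>Non-oscillation by the rank of \<open>S t0\<close>\<close>

lemma conjoined_solution_exists:
  assumes "cadj \<Phi>0 ** \<Psi>0 = cadj \<Psi>0 ** \<Phi>0"
  obtains \<Phi> \<Psi> where "ham_matrix_solution A (\<lambda>t. S t ** S t) C t0 \<Phi> \<Psi>" "conjoined t0 \<Phi> \<Psi>"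
    "\<Phi> t0 = \<Phi>0" "\<Psi> t0 = \<Psi>0"
proof -
  have c: "continuous_on {t0..} (\<lambda>t. S t ** S t)" by (intro continuous_intros contS)
  obtain \<Phi> \<Psi> where s: "ham_matrix_solution A (\<lambda>t. S t ** S t) C t0 \<Phi> \<Psi>" "\<Phi> t0 = \<Phi>0" "\<Psi> t0 = \<Psi>0"
    using ham_matrix_solution_exists[OF contA c contC] by blast
  have "conjoined t0 \<Phi> \<Psi>"
    by (rule ham_matrix_solution_conjoined[OF s(1)]) (use s hermS hermC assms in \<open>auto simp: cadj_mult\<close>)
  with s that show thesis by blast
qed

text \<open>Here \<open>S\<close> stays zero, the first equation decouples, and Liouville's formula
  keeps the determinant nonzero.\<close>

lemma non_oscillatory_rank0:
  assumes "S t0 = 0"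
  shows "ham_non_oscillatory A (\<lambda>t. S t ** S t) C t0"
proof -
  obtain \<Phi> \<Psi> where s: "ham_matrix_solution A (\<lambda>t. S t ** S t) C t0 \<Phi> \<Psi>" "conjoined t0 \<Phi> \<Psi>"
    and i: "\<Phi> t0 = mat 1" "\<Psi> t0 = mat 0"
    by (rule conjoined_solution_exists[of "mat 1" "mat 0"]) (auto simp: cadj_linear)
  have d: "((\<lambda>t. det (\<Phi> t)) has_vector_derivative trace (A t) * det (\<Phi> t)) (at t within {t0..})" if t: "t \<ge> t0" for t
  proof -
    have "S t = 0" by (rule S_zero[OF order_refl assms t])
    then have "(\<Phi> has_vector_derivative (A t ** \<Phi> t + \<Phi> t ** mat 0)) (at t within {t0..})"
      using s(1) t by (auto simp: ham_matrix_solution_def)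
    from has_vector_derivative_det2[OF this] show ?thesis by (simp add: trace_def sum_2)
  qed
  have "det (\<Phi> t) \<noteq> 0" if t: "t \<ge> t0" for t
  proof
    assume "det (\<Phi> t) = 0"
    have "det (\<Phi> t0) = 0"
    proof (rule linear_ode_unique[where L = "\<lambda>t x. trace (A t) * x", OF _ _ d t _ order_refl])
      show "linear ((*) (trace (A t)))" for t
        by (rule bounded_linear.linear[OF bounded_linear_mult_right])
      show "continuous_on {t0..} (\<lambda>t. trace (A t) * x)" for x
        unfolding trace_def sum_2 by (intro continuous_intros contA)
    qed (use \<open>det (\<Phi> t) = 0\<close> in auto)
    then show False by (simp add: i)
  qed
  then have "\<not> oscillatory_sol t0 \<Phi>" by (auto simp: oscillatory_sol_def)
  with s show ?thesis unfolding ham_non_oscillatory_def by blast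
qed

lemma lift_exists:
  assumes v: "vsol \<phi> \<psi>" and t1: "t1 \<ge> t0" and init: "S t1 *v c = \<phi> t1"
  obtains X where "X t1 = c"
    "\<And>t. t \<ge> t1 \<Longrightarrow> (X has_vector_derivative (P t *v X t + S t *v \<psi> t)) (at t within {t1..})"
    "\<And>t. t \<ge> t1 \<Longrightarrow> S t *v X t = \<phi> t"
proof -
  have sub: "{t1..} \<subseteq> {t0..}" using t1 by auto
  have "continuous_on {t1..} (\<lambda>t. S t *v \<psi> t)"
    by (rule continuous_on_subset[OF _ sub]) (intro continuous_intros contS vsol_continuous[OF v])
  from vector_ode_solution[OF continuous_on_subset[OF contP sub] this, of c]
  obtain X where X: "X t1 = c"
    "\<And>t. t \<ge> t1 \<Longrightarrow> (X has_vector_derivative (P t *v X t + S t *v \<psi> t)) (at t within {t1..})"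
    by blast
  have "S t *v X t = \<phi> t" if "t \<ge> t1" for t
    by (rule lift_eq[OF v t1 X(2) _ that]) (use X(1) init in auto)
  with X that show thesis by blast
qed

text \<open>For the solution that starts with zero and the identity, a later zero of the determinant
  gives a vector solution vanishing at both ends. As \<open>S\<close> stays invertible, its lift
  vanishes at both ends too, and rigidity contradicts the nonzero initial value of
  \<open>\<psi>\<close>.\<close>

lemma non_oscillatory_rank2:
  assumes "det (S t0) \<noteq> 0"
  shows "ham_non_oscillatory A (\<lambda>t. S t ** S t) C t0"
proof -
  obtain \<Phi> \<Psi> where s: "ham_matrix_solution A (\<lambda>t. S t ** S t) C t0 \<Phi> \<Psi>" "conjoined t0 \<Phi> \<Psi>"
    and i: "\<Phi> t0 = mat 0" "\<Psi> t0 = mat 1"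
    by (rule conjoined_solution_exists[of "mat 0" "mat 1"]) (auto simp: cadj_linear)
  have "det (\<Phi> t) \<noteq> 0" if t: "t > t0" for t
  proof
    assume "det (\<Phi> t) = 0"
    then obtain c where c: "c \<noteq> 0" "\<Phi> t *v c = 0" using det_eq_0_iff_kernel by blast
    define \<phi> \<psi> where "\<phi> = (\<lambda>t. \<Phi> t *v c)" and "\<psi> = (\<lambda>t. \<Psi> t *v c)"
    have v: "vsol \<phi> \<psi>" unfolding \<phi>_def \<psi>_def by (rule ham_matrix_solution_vsol[OF s(1)])
    have \<phi>0: "\<phi> t0 = 0" "\<phi> t = 0" and \<psi>0: "\<psi> t0 = c" using c i by (simp_all add: \<phi>_def \<psi>_def)
    obtain X where X: "X t0 = 0"
      "\<And>s. s \<ge> t0 \<Longrightarrow> (X has_vector_derivative (P s *v X s + S s *v \<psi> s)) (at s within {t0..})"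
      "\<And>s. s \<ge> t0 \<Longrightarrow> S s *v X s = \<phi> s"
      using lift_exists[OF v order_refl, of 0] \<phi>0 by (auto simp: matrix_vector_algebra)
    have "S t *v X t = 0" using X(3)[of t] t \<phi>0 by simp
    then have Xt: "X t = 0" using det_S_nonzero[OF assms, of t] t det_eq_0_iff_kernel[of "S t"] by auto
    have "S t0 *v \<psi> t0 = 0"
    proof (rule energy_rigid(2)[OF v order_refl t])
      show "(X has_vector_derivative (P s *v X s + S s *v \<psi> s)) (at s within {t0..t})" if "s \<in> {t0..t}" for s
        by (rule has_vector_derivative_within_subset[OF X(2)]) (use that in auto)
      show "S s *v X s = \<phi> s" if "s \<in> {t0..t}" for s using X(3)[of s] that by simp
    qed (use X(1) Xt \<phi>0 t in auto)
    then show False using assms c(1) det_eq_0_iff_kernel[of "S t0"] \<psi>0 by auto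
  qed
  then have "\<not> oscillatory_sol t0 \<Phi>"
    unfolding oscillatory_sol_def by (metis add.commute less_add_one max.bounded_iff order_less_le_trans)
  with s show ?thesis unfolding ham_non_oscillatory_def by blast
qed

text \<open>Solving \<open>f' = - A\<^sup>* f\<close> from \<open>f0\<close> keeps \<open>S f = 0\<close>, so \<open>f \<bullet> \<phi>\<close> is conserved.\<close>

lemma adjoint_kernel_constant:
  assumes v: "vsol \<phi> \<psi>" and f0: "S t0 *v f0 = 0" and t: "t \<ge> t0" and "\<phi> t = 0"
  shows "f0 \<bullet> \<phi> t0 = 0"
proof -
  have "continuous_on {t0..} (\<lambda>t. - cadj (A t))" by (intro continuous_intros contA)
  from vector_ode_solution[OF this continuous_on_const[of _ 0], of f0]
  obtain f where f0': "f t0 = f0"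
    and f: "\<And>t. t \<ge> t0 \<Longrightarrow> (f has_vector_derivative (- cadj (A t) *v f t)) (at t within {t0..})"
    by auto
  have Sf: "S s *v f s = 0" if "s \<ge> t0" for s
  proof (rule vector_ode_unique[where P = "\<lambda>t. - cadj (P t)", OF _ _ order_refl _ that])
    show "continuous_on {t0..} (\<lambda>t. - cadj (P t))" by (intro continuous_intros contP)
    show "S t0 *v f t0 = 0" using f0 f0' by simp
    show "((\<lambda>t. S t *v f t) has_vector_derivative - cadj (P s) *v (S s *v f s)) (at s within {t0..})"
      if s: "s \<ge> t0" for s
      by (rule has_vector_derivative_eq_rhs[OF has_vector_derivative_matrix_vector_mult[OF S'_adj[OF s] f[OF s]]])
        (simp add: matrix_vector_algebra)
  qed
  have "f t0 \<bullet> \<phi> t0 - f t \<bullet> \<phi> t = 0"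
  proof (rule linear_ode_zero[where D = "\<lambda>_. 0" and y = "\<lambda>s. f s \<bullet> \<phi> s - f t \<bullet> \<phi> t", OF _ _ t _ order_refl])
    fix s assume s: "s \<ge> t0"
    have a: "x \<bullet> (M *v y) = (cadj M *v x) \<bullet> y" for x y and M :: "complex^2^2"
      using inner_cadj[of "cadj M" x y] by simp
    show "((\<lambda>s. f s \<bullet> \<phi> s - f t \<bullet> \<phi> t) has_vector_derivative 0) (at s within {t0..})"
      by (rule has_vector_derivative_eq_rhs[OF has_vector_derivative_diff[OF
          bounded_bilinear.has_vector_derivative[OF bounded_bilinear_inner f[OF s] vsolD(1)[OF v s]]
          has_vector_derivative_const]])
        (simp add: inner_add_right a hermS[OF s] Sf[OF s] matrix_vector_algebra)
  qed (auto intro: exI[of _ 0])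
  then show ?thesis using f0' \<open>\<phi> t = 0\<close> by simp
qed

text \<open>The pair \<open>(\<phi>, S \<psi>)\<close> solves a closed linear system, although \<open>\<psi>\<close> is not determined by it.\<close>

lemma vsol_trivial:
  assumes v: "vsol \<phi> \<psi>" and t: "t \<ge> t0" and z: "\<phi> t = 0" "S t *v \<psi> t = 0"
  shows "\<phi> t0 = 0"
proof -
  define L where "L t y = (A t *v fst y + S t *v snd y, (S t ** C t) *v fst y - cadj (P t) *v snd y)"
    for t and y :: "(complex^2) \<times> (complex^2)"
  have "(\<phi> t0, S t0 *v \<psi> t0) = 0"
  proof (rule linear_ode_unique[where L = L, OF _ _ _ t _ order_refl])
    show "linear (L t)" for t
      unfolding L_def linear_iff
      by (auto simp: matrix_vector_algebra bounded_bilinear.scaleR_right[OF bounded_bilinear_matrix_vector_mult] algebra_simps)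
    show "continuous_on {t0..} (\<lambda>t. L t x)" for x
      unfolding L_def by (intro continuous_intros contA contS contC contP)
    show "(\<phi> t, S t *v \<psi> t) = 0" using z by (simp add: zero_prod_def)
    fix s assume s: "s \<ge> t0"
    have "((\<lambda>s. S s *v \<psi> s) has_vector_derivative
        ((S s ** C s) *v \<phi> s - cadj (P s) *v (S s *v \<psi> s))) (at s within {t0..})"
      by (rule has_vector_derivative_eq_rhs[OF has_vector_derivative_matrix_vector_mult[OF S'_adj[OF s] vsolD(2)[OF v s]]])
        (simp add: matrix_vector_algebra)
    from has_vector_derivative_Pair[OF vsolD(1)[OF v s] this]
    show "((\<lambda>t. (\<phi> t, S t *v \<psi> t)) has_vector_derivative L s (\<phi> s, S s *v \<psi> s)) (at s within {t0..})"
      by (simp add: L_def)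
  qed
  then show ?thesis by (simp add: zero_prod_def)
qed

text \<open>A lift of zero need only lie in the kernel of \<open>S\<close>, so two zeros do not
  suffice. The third leaves room to use different multiples of the solution on the two intervals:
  the combined lift vanishes at both outer zeros and is continuous at \<open>t2\<close>. The jump of
  \<open>\<psi>\<close> there does not affect the energy, as \<open>\<phi> t2 = 0\<close>.\<close>

lemma three_zeros_imp_trivial:
  assumes v: "vsol \<phi> \<psi>" and S0: "S t0 \<noteq> 0"
    and t: "t0 \<le> t1" "t1 < t2" "t2 < t3" and z: "\<phi> t1 = 0" "\<phi> t2 = 0" "\<phi> t3 = 0"
  shows "\<phi> t0 = 0"
proof -
  have t2: "t2 \<ge> t0" using t by simp
  obtain U1 where U1: "U1 t1 = 0"
    "\<And>t. t \<ge> t1 \<Longrightarrow> (U1 has_vector_derivative (P t *v U1 t + S t *v \<psi> t)) (at t within {t1..})"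
    "\<And>t. t \<ge> t1 \<Longrightarrow> S t *v U1 t = \<phi> t"
    using lift_exists[OF v t(1), of 0] z by (auto simp: matrix_vector_algebra)
  \<comment> \<open>\<open>N\<close> lifts the zero solution and continues, inside the kernel of
    \<open>S\<close>, the value that \<open>U1\<close> has reached at \<open>t2\<close>.\<close>
  obtain N where N: "N t2 = U1 t2"
    "\<And>t. t \<ge> t2 \<Longrightarrow> (N has_vector_derivative (P t *v N t)) (at t within {t2..})"
    "\<And>t. t \<ge> t2 \<Longrightarrow> S t *v N t = 0"
    using lift_exists[OF vsol_zero t2, of "U1 t2"] U1(3)[of t2] t z by (auto simp: matrix_vector_algebra)
  obtain U2 where U2: "U2 t2 = 0"
    "\<And>t. t \<ge> t2 \<Longrightarrow> (U2 has_vector_derivative (P t *v U2 t + S t *v \<psi> t)) (at t within {t2..})"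
    "\<And>t. t \<ge> t2 \<Longrightarrow> S t *v U2 t = \<phi> t"
    using lift_exists[OF v t2, of 0] z by (auto simp: matrix_vector_algebra)
  have "S t3 \<noteq> 0" using S_zero[of t3 t0] S0 t by auto
  moreover have "S t3 *v N t3 = 0" "S t3 *v U2 t3 = 0" using N(3)[of t3] U2(3)[of t3] t z by auto
  \<comment> \<open>Both end values lie in the kernel of the nonzero matrix \<open>S t3\<close>,
    hence on one line.\<close>
  ultimately obtain a b where ab: "a \<noteq> 0 \<or> b \<noteq> 0" "a *s N t3 + b *s U2 t3 = 0"
    by (rule two_kernel_vectors_dependent)
  define X1 X2 where "X1 t = a *s U1 t" and "X2 t = a *s N t + b *s U2 t" for t
  note sc = bounded_linear.has_vector_derivative[OF bounded_linear_vector_scalar_mult]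
  note lin = vector_scalar_commute vector_add_ldistrib matrix_vector_algebra
  have v1: "vsol (\<lambda>t. a *s \<phi> t) (\<lambda>t. a *s \<psi> t)" and v2: "vsol (\<lambda>t. b *s \<phi> t) (\<lambda>t. b *s \<psi> t)"
    by (rule vsol_scale[OF v])+
  have X1': "(X1 has_vector_derivative (P t *v X1 t + S t *v (a *s \<psi> t))) (at t within {t1..t2})"
    if "t \<in> {t1..t2}" for t
  proof -
    have "(U1 has_vector_derivative (P t *v U1 t + S t *v \<psi> t)) (at t within {t1..t2})"
      by (rule has_vector_derivative_within_subset[OF U1(2)]) (use that in auto)
    from sc[OF this, of a] show ?thesis unfolding X1_def[abs_def] by (simp add: lin)
  qed
  have X2': "(X2 has_vector_derivative (P t *v X2 t + S t *v (b *s \<psi> t))) (at t within {t2..t3})"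
    if "t \<in> {t2..t3}" for t
  proof -
    have n: "(N has_vector_derivative (P t *v N t)) (at t within {t2..t3})"
      by (rule has_vector_derivative_within_subset[OF N(2)]) (use that in auto)
    have u: "(U2 has_vector_derivative (P t *v U2 t + S t *v \<psi> t)) (at t within {t2..t3})"
      by (rule has_vector_derivative_within_subset[OF U2(2)]) (use that in auto)
    show ?thesis unfolding X2_def[abs_def]
      by (rule has_vector_derivative_eq_rhs[OF has_vector_derivative_add[OF sc[OF n, of a] sc[OF u, of b]]])
        (simp add: lin)
  qed
  have l1: "S t *v X1 t = a *s \<phi> t" if "t \<in> {t1..t2}" for t
    using U1(3)[of t] that by (simp add: X1_def lin)
  have l2: "S t *v X2 t = b *s \<phi> t" if "t \<in> {t2..t3}" for t
    using N(3)[of t] U2(3)[of t] that by (simp add: X2_def lin)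
  have X12: "X1 t1 = 0" "X2 t3 = 0" "X2 t2 = X1 t2" using U1(1) U2(1) N(1) ab(2) by (simp_all add: X1_def X2_def)
  \<comment> \<open>The energy on the second interval ends at zero, so it is nonpositive at
    \<open>t2\<close>. This is the end condition required for rigidity on the first
    interval.\<close>
  have e2: "- (X1 t2 \<bullet> (Z t2 *v X1 t2)) \<le> 0"
    using energy_mono[OF v2 t2 less_imp_le[OF t(3)] X2' l2] z X12 by simp
  have r1: "X1 s = 0 \<and> S s *v (a *s \<psi> s) = 0" if "s \<in> {t1..t2}" for s
    using energy_rigid[OF v1 t(1,2) X1' l1 X12(1) _ that] e2 z X12 by simp
  have X2t2: "X2 t2 = 0" using r1[of t2] X12 t by simp
  have r2: "S t2 *v (b *s \<psi> t2) = 0"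
    by (rule energy_rigid(2)[OF v2 t2 t(3) X2' l2 X2t2]) (use z X12 X2t2 t in auto)
  \<comment> \<open>Only one of the coefficients need be nonzero; the two intervals together cover
    either case.\<close>
  have "a *s (S t2 *v \<psi> t2) = 0" "b *s (S t2 *v \<psi> t2) = 0"
    using r1[of t2] r2 t by (auto simp: vector_scalar_commute)
  then have "S t2 *v \<psi> t2 = 0" using ab(1) by auto
  then show ?thesis by (rule vsol_trivial[OF v t2 z(2)])
qed

text \<open>For the solution starting with the identity and zero, the conserved products confine
  every kernel vector of \<Phi> at a zero of the determinant to one fixed line, spanned by
  \<open>e\<close>. All zeros thus belong to a single vector solution, which has a nonzero initial
  value and so fewer than three zeros.\<close>

lemma non_oscillatory_rank1:
  assumes S0: "S t0 \<noteq> 0" and det0: "det (S t0) = 0"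
  shows "ham_non_oscillatory A (\<lambda>t. S t ** S t) C t0"
proof -
  obtain \<Phi> \<Psi> where s: "ham_matrix_solution A (\<lambda>t. S t ** S t) C t0 \<Phi> \<Psi>" "conjoined t0 \<Phi> \<Psi>"
    and i: "\<Phi> t0 = mat 1" "\<Psi> t0 = mat 0"
    by (rule conjoined_solution_exists[of "mat 1" "mat 0"]) (auto simp: cadj_linear)
  obtain f0 where f0: "f0 \<noteq> 0" "S t0 *v f0 = 0" using det0 det_eq_0_iff_kernel by blast
  \<comment> \<open>The inner product is real; adding the multiple by \<open>\<i>\<close> yields
    complex orthogonality to \<open>f0\<close>.\<close>
  have if0: "S t0 *v (\<i> *s f0) = 0" using f0 by (simp add: vector_scalar_commute)
  obtain e where e: "e \<noteq> 0" "\<And>c. f0 \<bullet> c = 0 \<Longrightarrow> (\<i> *s f0) \<bullet> c = 0 \<Longrightarrow> \<exists>k. c = k *s e"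
    using orthogonal_complement_line[OF f0(1)] by metis
  have ker: "\<Phi> t *v e = 0" if t: "t \<ge> t0" and det: "det (\<Phi> t) = 0" for t
  proof -
    obtain c where c: "c \<noteq> 0" "\<Phi> t *v c = 0" using det unfolding det_eq_0_iff_kernel by blast
    have v: "vsol (\<lambda>t. \<Phi> t *v c) (\<lambda>t. \<Psi> t *v c)" by (rule ham_matrix_solution_vsol[OF s(1)])
    have "f0 \<bullet> c = 0" "(\<i> *s f0) \<bullet> c = 0"
      using adjoint_kernel_constant[OF v f0(2) t c(2)] adjoint_kernel_constant[OF v if0 t c(2)] by (simp_all add: i)
    then obtain k where "c = k *s e" using e(2) by blast
    then show ?thesis using c by (auto simp: vector_scalar_commute)
  qed
  have "\<not> oscillatory_sol t0 \<Phi>"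
  proof
    assume osc: "oscillatory_sol t0 \<Phi>"
    have ex: "\<exists>t>T. t \<ge> t0 \<and> det (\<Phi> t) = 0" for T
    proof -
      obtain t where "t \<ge> max (T + 1) t0" "det (\<Phi> t) = 0"
        using osc unfolding oscillatory_sol_def by blast
      then show ?thesis by (intro exI[of _ t]) auto
    qed
    obtain t1 where t1: "t1 \<ge> t0" "det (\<Phi> t1) = 0" using ex[of t0] by blast
    obtain t2 where t2: "t2 > t1" "det (\<Phi> t2) = 0" using ex[of t1] by blast
    obtain t3 where t3: "t3 > t2" "det (\<Phi> t3) = 0" using ex[of t2] by blast
    have "\<Phi> t0 *v e = 0"
      using three_zeros_imp_trivial[OF ham_matrix_solution_vsol[OF s(1), of e] S0 t1(1) t2(1) t3(1)]
        ker[of t1] ker[of t2] ker[of t3] t1 t2 t3 by simp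
    then show False using e(1) by (simp add: i)
  qed
  with s show ?thesis unfolding ham_non_oscillatory_def by blast
qed

lemma non_oscillatory: "ham_non_oscillatory A (\<lambda>t. S t ** S t) C t0"
  using non_oscillatory_rank0 non_oscillatory_rank1 non_oscillatory_rank2 by blast

end

theorem theorem3p4:
  fixes A B C F S dS P Q :: "real \<Rightarrow> complex^2^2"
    and dp12 dp21 :: "real \<Rightarrow> complex"
    and t0 :: real
  assumes contA: "continuous_on {t0..} A"
    and contB: "continuous_on {t0..} B"
    and contC: "continuous_on {t0..} C"
    and hermB: "\<forall>t\<ge>t0. cadj (B t) = B t"
    and hermC: "\<forall>t\<ge>t0. cadj (C t) = C t"
    and nnB: "\<forall>t\<ge>t0. nonneg_def (B t)"
    and S_def: "S = (\<lambda>t. msqrt (B t))"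
    and derS: "\<forall>t\<ge>t0. (S has_vector_derivative dS t) (at t within {t0..})"
    and contdS: "continuous_on {t0..} dS"
    and contF: "continuous_on {t0..} F"
    and eqF: "\<forall>t\<ge>t0. S t ** F t ** (A t ** S t - dS t) = A t ** S t - dS t"
    and P_def: "P = (\<lambda>t. F t ** (A t ** S t - dS t))"
    and Q_def: "Q = (\<lambda>t. S t ** C t ** S t)"
    and der12: "\<forall>t\<ge>t0. ((\<lambda>s. P s $ 1 $ 2) has_vector_derivative dp12 t) (at t within {t0..})"
    and contd12: "continuous_on {t0..} dp12"
    and der21: "\<forall>t\<ge>t0. ((\<lambda>s. P s $ 2 $ 1) has_vector_derivative dp21 t) (at t within {t0..})"
    and contd21: "continuous_on {t0..} dp21"
    and c4_1: "cond4 (\<lambda>s. Re (P s $ 1 $ 1)) (chi3 P Q dp21 t0) t0"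
    and c4_2: "cond4 (\<lambda>s. Re (P s $ 2 $ 2)) (chi4 P Q dp12 t0) t0"
  shows "ham_non_oscillatory A B C t0"
proof -
  have contS: "continuous_on {t0..} S"
    by (rule has_vector_derivative_imp_continuous_on) (use derS in auto)
  have hermS: "cadj (S t) = S t" and SS: "S t ** S t = B t" if "t \<ge> t0" for t
    using msqrt_nonneg_square[of "B t"] nnB that by (auto simp: S_def nonneg_def_def)
  have contP: "continuous_on {t0..} P"
    unfolding P_def by (intro continuous_intros contF contA contS contdS)
  have contQ: "continuous_on {t0..} Q"
    unfolding Q_def by (intro continuous_intros contS contC)
  have hermQ: "cadj (Q t) = Q t" if "t \<ge> t0" for t
    using that hermC hermS[OF that] by (simp add: Q_def cadj_mult matrix_mul_assoc)
  \<comment> \<open>The condition on \<open>F\<close> says exactly that \<open>S t ** P t\<close>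
    equals \<open>A t ** S t - dS t\<close>.\<close>
  have dS: "dS t = A t ** S t - S t ** P t" if "t \<ge> t0" for t
  proof -
    have "S t ** P t = A t ** S t - dS t"
      using eqF that by (simp add: P_def matrix_mul_assoc)
    then show ?thesis by simp
  qed
  obtain Z where Z: "\<And>t. t \<ge> t0 \<Longrightarrow> cadj (Z t) = Z t"
    "\<And>t. t \<ge> t0 \<Longrightarrow> (Z has_vector_derivative riccati_rhs (P t) (Q t) (Z t)) (at t within {t0..})"
    using riccati_global[OF contP contQ hermQ der12 contd12 der21 contd21 c4_1 c4_2] by metis
  interpret factored_hamiltonian A C S P Z t0
  proof
    show "(Z has_vector_derivative riccati_rhs (P t) (S t ** C t ** S t) (Z t)) (at t within {t0..})" if "t \<ge> t0" for t
      using Z(2)[OF that] by (simp add: Q_def)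
    show "(S has_vector_derivative (A t ** S t - S t ** P t)) (at t within {t0..})" if "t \<ge> t0" for t
      using derS[rule_format, OF that] unfolding dS[OF that] .
  qed (use contA contC contP hermC hermS Z(1) in auto)
  show ?thesis
    using non_oscillatory ham_matrix_solution_cong[of t0 "\<lambda>t. S t ** S t" B A C] SS
    by (simp add: ham_non_oscillatory_def)
qed

end
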